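(* Let $G$ be a Garside group with Garside element $\Delta$ and Garside generators $S$. Then there is a total ordering of $X:=S\cup S^{-1}$ with respect to which $G$ is shortlex automatic.
   Context: A Garside monoid is a finitely generated cancellative monoid $G^+$ in which, for each element, the number of factors in its expressions as a product of non-identity elements is bounded, any two elements have least common multiples and greatest common divisors on the left and on the right, and which contains an element $\Delta$ (the Garside element) whose sets of left divisors and right divisors coincide, are finite, and generate $G^+$. (Here if $c=ab$ in $G^+$ then $a$ is a left divisor and $b$ a right divisor of $c$.) The Garside group $G$ is the group of fractions of $G^+$, i.e. the group defined by the same presentation as $G^+$; $G^+$ embeds in $G$. The set $S$ of Garside generators is the set of non-identity divisors of $\Delta$ in $G^+$, viewed as elements of $G$. Given a total ordering of $X$, the shortlex ordering on $X^*$ compares words first by length and then, for equal length, lexicographically; $\mathsf{SL}(G,X)$ is the set of words $y_g$ ($g\in G$), where $y_g$ is the shortlex least word representing $g$. $G$ is shortlex automatic with respect to the ordered generating set $X$ if $\mathsf{SL}(G,X)$ is the language of an automatic structure for $G$. *)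

theory Defs
  imports "HOL-Algebra.Divisibility"
begin

section \<open>Garside monoids and their groups of fractions\<close>

definition word_prod :: "('a, 'm) monoid_scheme \<Rightarrow> 'a list \<Rightarrow> 'a" where
  "word_prod M w = foldr (\<otimes>\<^bsub>M\<^esub>) w \<one>\<^bsub>M\<^esub>"

definition monoid_generates :: "('a, 'm) monoid_scheme \<Rightarrow> 'a set \<Rightarrow> bool" where
  "monoid_generates M A \<longleftrightarrow> A \<subseteq> carrier M \<and> word_prod M ` lists A = carrier M"

text \<open>
  The library relation \<open>a divides\<^bsub>M\<^esub> c\<close> means \<open>c = a \<otimes> b\<close> for some \<open>b\<close>, so in a
  non-commutative monoid it is left divisibility, and \<open>gcdof\<close> and \<open>lcmof\<close> are the
  corresponding notions for left divisibility.  The notions for right divisibility are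
  obtained by passing to the opposite monoid.
\<close>

definition opposite :: "('a, 'm) monoid_scheme \<Rightarrow> ('a, 'm) monoid_scheme" where
  "opposite M = M\<lparr>mult := \<lambda>x y. y \<otimes>\<^bsub>M\<^esub> x\<rparr>"

definition left_divisors :: "('a, 'm) monoid_scheme \<Rightarrow> 'a \<Rightarrow> 'a set" where
  "left_divisors M c = {a \<in> carrier M. a divides\<^bsub>M\<^esub> c}"

definition right_divisors :: "('a, 'm) monoid_scheme \<Rightarrow> 'a \<Rightarrow> 'a set" where
  "right_divisors M c = {b \<in> carrier M. b divides\<^bsub>opposite M\<^esub> c}"

locale garside_monoid = monoid_cancel M for M :: "('a, 'm) monoid_scheme" (structure) +
  fixes \<Delta> :: 'a
  assumes finitely_generated: "\<exists>A. finite A \<and> monoid_generates M A"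
    and bounded_factorizations:
      "a \<in> carrier M \<Longrightarrow>
        \<exists>N. \<forall>w \<in> lists (carrier M - {\<one>}). word_prod M w = a \<longrightarrow> length w \<le> N"
    and left_gcd:
      "\<lbrakk>a \<in> carrier M; b \<in> carrier M\<rbrakk> \<Longrightarrow> \<exists>c \<in> carrier M. c gcdof\<^bsub>M\<^esub> a b"
    and left_lcm:
      "\<lbrakk>a \<in> carrier M; b \<in> carrier M\<rbrakk> \<Longrightarrow> \<exists>c \<in> carrier M. c lcmof\<^bsub>M\<^esub> a b"
    and right_gcd:
      "\<lbrakk>a \<in> carrier M; b \<in> carrier M\<rbrakk> \<Longrightarrow> \<exists>c \<in> carrier M. c gcdof\<^bsub>opposite M\<^esub> a b"
    and right_lcm:
      "\<lbrakk>a \<in> carrier M; b \<in> carrier M\<rbrakk> \<Longrightarrow> \<exists>c \<in> carrier M. c lcmof\<^bsub>opposite M\<^esub> a b"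
    and Delta_closed: "\<Delta> \<in> carrier M"
    and Delta_divisors: "left_divisors M \<Delta> = right_divisors M \<Delta>"
    and Delta_divisors_finite: "finite (left_divisors M \<Delta>)"
    and Delta_divisors_generate: "monoid_generates M (left_divisors M \<Delta>)"

text \<open>
  \<open>G\<close>, together with the embedding \<open>\<iota>\<close> of \<open>M\<close>, is a group of (right) fractions of \<open>M\<close>.
  For a monoid with common multiples, \<open>(G, \<iota>)\<close> is determined by this up to a unique
  isomorphism, every element is also a left fraction, and \<open>G\<close> has the same
  presentation as a group that \<open>M\<close> has as a monoid.
\<close>

locale group_of_fractions = M: monoid M + G: group G
  for M :: "('a, 'm) monoid_scheme" and G :: "('g, 'n) monoid_scheme" +
  fixes \<iota> :: "'a \<Rightarrow> 'g"
  assumes embedding_hom: "\<iota> \<in> hom M G"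
    and embedding_one: "\<iota> \<one>\<^bsub>M\<^esub> = \<one>\<^bsub>G\<^esub>"
    and embedding_inj: "inj_on \<iota> (carrier M)"
    and fractions:
      "g \<in> carrier G \<Longrightarrow> \<exists>a \<in> carrier M. \<exists>b \<in> carrier M. g = \<iota> a \<otimes>\<^bsub>G\<^esub> inv\<^bsub>G\<^esub> \<iota> b"

definition garside_generators ::
  "('a, 'm) monoid_scheme \<Rightarrow> 'a \<Rightarrow> ('a \<Rightarrow> 'g) \<Rightarrow> 'g set" where
  "garside_generators M \<Delta> \<iota> = \<iota> ` (left_divisors M \<Delta> - {\<one>\<^bsub>M\<^esub>})"


section \<open>Regular languages\<close>

text \<open>
  The languages over \<open>A\<close> accepted by a deterministic finite automaton with state set \<open>Q\<close>,
  transition function \<open>\<delta>\<close>, initial state \<open>q\<^sub>0\<close> and accepting states \<open>F\<close>.  Taking states to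
  be natural numbers is no restriction, since \<open>Q\<close> is finite.
\<close>

definition regular_language :: "'x set \<Rightarrow> 'x list set \<Rightarrow> bool" where
  "regular_language A L \<longleftrightarrow> finite A \<and>
    (\<exists>(Q :: nat set) \<delta> q\<^sub>0 F.
      finite Q \<and> q\<^sub>0 \<in> Q \<and> F \<subseteq> Q \<and> (\<forall>q \<in> Q. \<forall>a \<in> A. \<delta> q a \<in> Q) \<and>
      L = {w \<in> lists A. foldl \<delta> q\<^sub>0 w \<in> F})"


section \<open>Automatic structures\<close>

text \<open>
  A pair of words is read by a synchronous two-tape automaton as a single word of pairs, the
  shorter word being padded at its end by a symbol outside the alphabet (here \<open>None\<close>).
\<close>

fun padded_pair :: "'x list \<Rightarrow> 'x list \<Rightarrow> ('x option \<times> 'x option) list" where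
  "padded_pair [] [] = []"
| "padded_pair (x # u) [] = (Some x, None) # padded_pair u []"
| "padded_pair [] (y # v) = (None, Some y) # padded_pair [] v"
| "padded_pair (x # u) (y # v) = (Some x, Some y) # padded_pair u v"

definition padded_alphabet :: "'x set \<Rightarrow> ('x option \<times> 'x option) set" where
  "padded_alphabet X =
    (insert None (Some ` X) \<times> insert None (Some ` X)) - {(None, None)}"

text \<open>
  \<open>L\<close> is the language of an automatic structure for \<open>G\<close> over \<open>X\<close> in the sense of Epstein et
  al., \<^emph>\<open>Word Processing in Groups\<close>: it is accepted by a word acceptor, maps onto \<open>G\<close>, and
  for every generator, and also for the empty word (the case \<open>x = \<one>\<^bsub>G\<^esub>\<close>), there is a
  multiplier automaton.
\<close>

definition automatic_structure ::
  "('g, 'n) monoid_scheme \<Rightarrow> 'g set \<Rightarrow> 'g list set \<Rightarrow> bool" where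
  "automatic_structure G X L \<longleftrightarrow>
    X \<subseteq> carrier G \<and> regular_language X L \<and> word_prod G ` L = carrier G \<and>
    (\<forall>x \<in> insert \<one>\<^bsub>G\<^esub> X.
      regular_language (padded_alphabet X)
        {padded_pair u v | u v. u \<in> L \<and> v \<in> L \<and> word_prod G u \<otimes>\<^bsub>G\<^esub> x = word_prod G v})"

text \<open>
  Orderings of \<open>X\<close> are reflexive, in the sense of \<^const>\<open>linear_order_on\<close>, whereas \<^const>\<open>lenlex\<close>
  expects a strict relation.
\<close>

definition shortlex_less :: "('x \<times> 'x) set \<Rightarrow> ('x list \<times> 'x list) set" where
  "shortlex_less r = lenlex (r - Id)"

definition shortlex_least_word ::
  "('g, 'n) monoid_scheme \<Rightarrow> 'g set \<Rightarrow> ('g \<times> 'g) set \<Rightarrow> 'g \<Rightarrow> 'g list \<Rightarrow> bool" where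
  "shortlex_least_word G X r g w \<longleftrightarrow>
    w \<in> lists X \<and> word_prod G w = g \<and>
    (\<forall>v \<in> lists X. word_prod G v = g \<longrightarrow> v = w \<or> (w, v) \<in> shortlex_less r)"

definition SL ::
  "('g, 'n) monoid_scheme \<Rightarrow> 'g set \<Rightarrow> ('g \<times> 'g) set \<Rightarrow> 'g list set" where
  "SL G X r = {w. \<exists>g \<in> carrier G. shortlex_least_word G X r g w}"

definition shortlex_automatic ::
  "('g, 'n) monoid_scheme \<Rightarrow> 'g set \<Rightarrow> ('g \<times> 'g) set \<Rightarrow> bool" where
  "shortlex_automatic G X r \<longleftrightarrow>
    linear_order_on X r \<and> automatic_structure G X (SL G X r)"

end

theory Submission
  imports Defs
begin

text \<open>
  Order \<open>G\<close> by \<open>x \<preceq> y\<close> iff \<open>x\<inverse>y\<close> lies in the image \<open>P\<close> of \<open>M\<close>; this is a left-invariant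
  order in which any two elements have a meet, and right multiplication by \<open>\<Delta>\<close> preserves it.
  The generators are the non-identity elements of \<open>[\<Delta>\<inverse>, \<one>] \<union> [\<one>, \<Delta>]\<close>.  Order them
  so that \<open>\<preceq>\<close>-larger letters come first; in particular positive letters precede negative ones.
  Comparing a shortlex least word with the words obtained by rewriting two adjacent letters
  greedily, or by moving a letter \<open>\<Delta>\<close> or \<open>\<Delta>\<inverse>\<close> through the word, one finds that
  every pair of adjacent letters is left greedy and that \<open>\<Delta>\<close> and \<open>\<Delta>\<inverse>\<close> do not occur
  together with letters of the opposite sign.  Conversely, let \<open>w\<close> be any word with these
  properties, representing \<open>g\<close>.  Its number \<open>b\<close> of positive letters is the least one with
  \<open>g \<preceq> \<Delta>\<^sup>b\<close>, its number \<open>a\<close> of negative letters is the least one with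
  \<open>\<one> \<preceq> g\<Delta>\<^sup>a\<close>, and a prefix with \<open>k\<close> positive letters that leaves out \<open>j\<close> negative
  letters represents \<open>g\<Delta>\<^sup>j \<curlywedge> \<Delta>\<^sup>k\<close>.  Hence \<open>w\<close> is determined by \<open>g\<close>, so the
  shortlex least words are characterised by a condition that a finite automaton can check.
  The same formula shows that the words of \<open>g\<close> and \<open>gx\<close>, for a generator \<open>x\<close>, stay
  within the finite interval \<open>[\<Delta>\<^sup>-\<^sup>2, \<Delta>\<^sup>2]\<close> of each other, which yields the multipliers.
\<close>

section \<open>Products of words in a monoid\<close>

lemma word_prod_Nil [simp]: "word_prod M [] = \<one>\<^bsub>M\<^esub>"
  by (simp add: word_prod_def)

lemma word_prod_Cons [simp]: "word_prod M (x # w) = x \<otimes>\<^bsub>M\<^esub> word_prod M w"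
  by (simp add: word_prod_def)

lemma (in monoid) word_prod_closed [simp]:
  "set w \<subseteq> carrier G \<Longrightarrow> word_prod G w \<in> carrier G"
  by (induction w) auto

lemma (in monoid) word_prod_append:
  "\<lbrakk>set u \<subseteq> carrier G; set v \<subseteq> carrier G\<rbrakk> \<Longrightarrow>
    word_prod G (u @ v) = word_prod G u \<otimes> word_prod G v"
  by (induction u) (auto simp: m_assoc)

section \<open>Automata\<close>

text \<open>A finite state set of any type is numbered injectively, so that automata can be built
  from structured states. \<open>F\<close> may contain states outside \<open>Q\<close>; only
  \<open>F \<inter> Q\<close> is transported.\<close>

lemma regular_languageI:
  fixes \<delta> :: "'s \<Rightarrow> 'x \<Rightarrow> 's"
  assumes "finite A" "finite Q" "q\<^sub>0 \<in> Q"
    and \<delta>: "\<And>q a. \<lbrakk>q \<in> Q; a \<in> A\<rbrakk> \<Longrightarrow> \<delta> q a \<in> Q"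
    and L: "L = {w \<in> lists A. foldl \<delta> q\<^sub>0 w \<in> F}"
  shows "regular_language A L"
proof -
  obtain f :: "'s \<Rightarrow> nat" where f: "inj_on f Q"
    using finite_imp_inj_to_nat_seg[OF assms(2)] by metis
  define \<delta>' where "\<delta>' n a = f (\<delta> (inv_into Q f n) a)" for n a
  have run: "foldl \<delta>' (f q) w = f (foldl \<delta> q w) \<and> foldl \<delta> q w \<in> Q"
    if "w \<in> lists A" "q \<in> Q" for w q
    using that f \<delta> by (induction w arbitrary: q) (auto simp: \<delta>'_def)
  have "w \<in> L \<longleftrightarrow> w \<in> lists A \<and> foldl \<delta>' (f q\<^sub>0) w \<in> f ` (F \<inter> Q)" for w
  proof (cases "w \<in> lists A")
    case True
    then show ?thesis
      using run[of w q\<^sub>0] assms(3) inj_on_image_mem_iff[OF f, of "foldl \<delta> q\<^sub>0 w" "F \<inter> Q"]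
      unfolding L by simp
  qed (simp add: L)
  then have "L = {w \<in> lists A. foldl \<delta>' (f q\<^sub>0) w \<in> f ` (F \<inter> Q)}"
    by blast
  moreover have "\<forall>n \<in> f ` Q. \<forall>a \<in> A. \<delta>' n a \<in> f ` Q"
    using f \<delta> by (auto simp: \<delta>'_def)
  moreover have "finite (f ` Q)" "f q\<^sub>0 \<in> f ` Q" "f ` (F \<inter> Q) \<subseteq> f ` Q"
    using assms by auto
  ultimately show ?thesis
    unfolding regular_language_def using assms(1) by blast
qed

text \<open>It suffices to remember the first and the most recent letter. \<open>None\<close> is the
  initial state, \<open>Some None\<close> the dead state, and \<open>Some (Some (h, l))\<close>
  records the first letter \<open>h\<close> and the most recent letter \<open>l\<close>.\<close>

lemma regular_language_successively:
  fixes R C :: "'x \<Rightarrow> 'x \<Rightarrow> bool"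
  assumes "finite A"
  shows "regular_language A
    {w \<in> lists A. successively R w \<and> (w = [] \<or> C (hd w) (last w))}"
proof -
  define \<delta> where "\<delta> q x = (case q of None \<Rightarrow> Some (Some (x, x)) | Some None \<Rightarrow> Some None
    | Some (Some (h, l)) \<Rightarrow> if R l x then Some (Some (h, x)) else Some None)"
    for q :: "('x \<times> 'x) option option" and x
  define Q :: "('x \<times> 'x) option option set"
    where "Q = insert None (insert (Some None) ((\<lambda>p. Some (Some p)) ` (A \<times> A)))"
  define F where "F = insert None ((\<lambda>p. Some (Some p)) ` {(h, l). C h l})"
  have fail: "foldl \<delta> (Some None) w = Some None" for w
    by (induction w) (simp_all add: \<delta>_def)
  have run: "foldl \<delta> (Some (Some (h, l))) w =
      (if successively R (l # w) then Some (Some (h, last (l # w))) else Some None)" for h l w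
  proof (induction w arbitrary: l)
    case (Cons x w)
    have "foldl \<delta> (Some (Some (h, l))) (x # w) =
        foldl \<delta> (if R l x then Some (Some (h, x)) else Some None) w"
      by (simp add: \<delta>_def)
    then show ?case
      using Cons by (simp add: fail)
  qed simp
  show ?thesis
  proof (rule regular_languageI[of A Q None \<delta> _ F])
    show "finite Q" using assms by (simp add: Q_def)
    show "\<delta> q a \<in> Q" if "q \<in> Q" "a \<in> A" for q a
      using that by (auto simp: Q_def \<delta>_def split: if_splits)
    have "foldl \<delta> None w \<in> F \<longleftrightarrow> successively R w \<and> (w = [] \<or> C (hd w) (last w))" for w
    proof (cases w)
      case (Cons x v)
      then have "foldl \<delta> None w = foldl \<delta> (Some (Some (x, x))) v"
        by (simp add: \<delta>_def)
      then show ?thesis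
        using Cons by (auto simp: F_def run)
    qed (simp add: F_def)
    then show "{w \<in> lists A. successively R w \<and> (w = [] \<or> C (hd w) (last w))} =
        {w \<in> lists A. foldl \<delta> None w \<in> F}"
      by simp
  qed (use assms in \<open>auto simp: Q_def\<close>)
qed

section \<open>Padded pairs and multiplier automata\<close>

definition opt_hd :: "'x list \<Rightarrow> 'x option" where
  "opt_hd w = (if w = [] then None else Some (hd w))"

lemma opt_hd_simps [simp]: "opt_hd [] = None" "opt_hd (x # w) = Some x"
  by (simp_all add: opt_hd_def)

lemma padded_pair_Nil_iff: "padded_pair u v = [] \<longleftrightarrow> u = [] \<and> v = []"
  by (cases "(u, v)" rule: padded_pair.cases) auto

lemma padded_pair_Cons_iff:
  "padded_pair u v = (a, b) # z \<longleftrightarrow> (u, v) \<noteq> ([], []) \<and> a = opt_hd u \<and> b = opt_hd v \<and>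
    z = padded_pair (tl u) (tl v)"
  by (cases "(u, v)" rule: padded_pair.cases) auto

lemma padded_pair_lists:
  "\<lbrakk>u \<in> lists X; v \<in> lists X\<rbrakk> \<Longrightarrow> padded_pair u v \<in> lists (padded_alphabet X)"
  by (induction u v rule: padded_pair.induct) (auto simp: padded_alphabet_def)

context group
begin

text \<open>A padding symbol counts as the identity, so a tape that has ended keeps its group
  element.\<close>

definition opt_val :: "'a option \<Rightarrow> 'a" where
  "opt_val a = (case a of None \<Rightarrow> \<one> | Some x \<Rightarrow> x)"

lemma opt_val_closed:
  "\<lbrakk>X \<subseteq> carrier G; a \<in> insert None (Some ` X)\<rbrakk> \<Longrightarrow> opt_val a \<in> carrier G"
  by (auto simp: opt_val_def)

lemma word_prod_take_Suc:
  "set u \<subseteq> carrier G \<Longrightarrow>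
    word_prod G (take (Suc i) u) = opt_val (opt_hd u) \<otimes> word_prod G (take i (tl u))"
  by (cases u) (auto simp: opt_val_def)

text \<open>Word differences: besides the states of two copies of the word acceptor, the automaton
  stores the inverse of the prefix read on the first tape times the prefix read on the second. By
  \<open>near\<close> this stays in the finite set \<open>D\<close> along every pair to be accepted,
  so other runs may be cut off.\<close>

lemma regular_language_multiplier:
  assumes X: "X \<subseteq> carrier G" and L: "regular_language X L"
    and D: "finite D" "D \<subseteq> carrier G" and x: "x \<in> carrier G"
    and near: "\<And>u v i. \<lbrakk>u \<in> L; v \<in> L; word_prod G u \<otimes> x = word_prod G v\<rbrakk> \<Longrightarrow>
      inv (word_prod G (take i u)) \<otimes> word_prod G (take i v) \<in> D"
  shows "regular_language (padded_alphabet X)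
    {padded_pair u v | u v. u \<in> L \<and> v \<in> L \<and> word_prod G u \<otimes> x = word_prod G v}"
proof -
  obtain Q :: "nat set" and \<delta> q\<^sub>0 F where Q: "finite X" "finite Q" "q\<^sub>0 \<in> Q" "F \<subseteq> Q"
    "\<And>q a. \<lbrakk>q \<in> Q; a \<in> X\<rbrakk> \<Longrightarrow> \<delta> q a \<in> Q" and L_eq: "L = {w \<in> lists X. foldl \<delta> q\<^sub>0 w \<in> F}"
    using L unfolding regular_language_def by blast
  \<comment> \<open>\<open>None\<close> is the state of a tape whose word has ended, so that only padding may follow.\<close>
  define step where "step p a = (case p of
      None \<Rightarrow> (case a of None \<Rightarrow> Some None | Some _ \<Rightarrow> None)
    | Some q \<Rightarrow> (case a of None \<Rightarrow> if q \<in> F then Some None else None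
        | Some y \<Rightarrow> Some (Some (\<delta> q y))))" for p a
  \<comment> \<open>\<open>lang p\<close> collects the words that a tape in state \<open>p\<close>
    may still read.\<close>
  define lang where "lang p = (case p of None \<Rightarrow> {[]}
    | Some q \<Rightarrow> {w \<in> lists X. foldl \<delta> q w \<in> F})" for p
  \<comment> \<open>The identity is added so that the initial state is legitimate even when no pair
    is to be accepted.\<close>
  define D' where "D' = insert \<one> D"
  define T where "T s ab = (case s of None \<Rightarrow> None | Some (p, q, h) \<Rightarrow>
    (case (step p (fst ab), step q (snd ab)) of
      (Some p', Some q') \<Rightarrow>
        (let h' = inv (opt_val (fst ab)) \<otimes> h \<otimes> opt_val (snd ab)
         in if h' \<in> D' then Some (p', q', h') else None)
    | _ \<Rightarrow> None))" for s ab
  define S where "S = insert None (Some ` (insert None (Some ` Q) \<times> insert None (Some ` Q) \<times> D'))"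
  define Acc where "Acc = {Some (p, q, h) | p q h. [] \<in> lang p \<and> [] \<in> lang q \<and> h = x}"
  have fail: "foldl T None z = None" for z
    by (induction z) (simp_all add: T_def)
  have lang_X: "u \<in> lists X" if "u \<in> lang p" for u p
    using that by (auto simp: lang_def split: option.splits)
  have lang_c: "set u \<subseteq> carrier G" if "u \<in> lang p" for u p
    using lang_X[OF that] X by auto
  have lang_step: "\<exists>p'. step p (opt_hd u) = Some p' \<and> tl u \<in> lang p'" if "u \<in> lang p" for u p
    using that by (cases u; cases p) (auto simp: step_def lang_def)
  have step_lang: "\<exists>u. u \<in> lang p \<and> opt_hd u = a \<and> tl u = u'"
    if "step p a = Some p'" "u' \<in> lang p'" "a \<in> insert None (Some ` X)" for p a p' u'
  proof (cases a)
    case None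
    then show ?thesis
      using that by (intro exI[of _ "[]"]) (auto simp: step_def lang_def split: option.splits if_splits)
  next
    case (Some y)
    then show ?thesis
      using that by (intro exI[of _ "y # u'"]) (auto simp: step_def lang_def split: option.splits)
  qed
  \<comment> \<open>Reading one pair of symbols updates the difference \<open>h\<close>; the later
    differences of the full words are those of the tails, started from the updated value.\<close>
  have shift: "inv (word_prod G (take (Suc i) u)) \<otimes> h \<otimes> word_prod G (take (Suc i) v) =
      inv (word_prod G (take i (tl u))) \<otimes> (inv (opt_val (opt_hd u)) \<otimes> h \<otimes> opt_val (opt_hd v)) \<otimes>
        word_prod G (take i (tl v))"
    if "set u \<subseteq> carrier G" "set v \<subseteq> carrier G" "h \<in> carrier G" for u v h i
  proof -
    have "set (take i (tl w)) \<subseteq> carrier G \<and> opt_val (opt_hd w) \<in> carrier G"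
      if "set w \<subseteq> carrier G" for w
      using that by (cases w) (auto simp: opt_val_def dest: in_set_takeD)
    then have "word_prod G (take i (tl u)) \<in> carrier G" "opt_val (opt_hd u) \<in> carrier G"
      "word_prod G (take i (tl v)) \<in> carrier G" "opt_val (opt_hd v) \<in> carrier G"
      using that by auto
    then show ?thesis
      using that by (simp add: word_prod_take_Suc inv_mult_group m_assoc)
  qed
  have shift_all: "inv (word_prod G u) \<otimes> h \<otimes> word_prod G v =
      inv (word_prod G (tl u)) \<otimes> (inv (opt_val (opt_hd u)) \<otimes> h \<otimes> opt_val (opt_hd v)) \<otimes>
        word_prod G (tl v)"
    if "set u \<subseteq> carrier G" "set v \<subseteq> carrier G" "h \<in> carrier G" for u v h
    using shift[OF that, of "max (length u) (length v)"] by simp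
  have D'c: "h \<in> carrier G" if "h \<in> D'" for h
    using that D(2) by (auto simp: D'_def)
  \<comment> \<open>Generalised over both tape states and the difference, since each symbol read
    changes all three.\<close>
  have run: "foldl T (Some (p, q, h)) z \<in> Acc \<longleftrightarrow>
      (\<exists>u \<in> lang p. \<exists>v \<in> lang q. z = padded_pair u v \<and> inv (word_prod G u) \<otimes> h \<otimes> word_prod G v = x \<and>
        (\<forall>i. inv (word_prod G (take i u)) \<otimes> h \<otimes> word_prod G (take i v) \<in> D'))"
    if "z \<in> lists (padded_alphabet X)" "h \<in> D'" for p q h z
    using that
  proof (induction z arbitrary: p q h rule: list.induct)
    case Nil
    have "foldl T (Some (p, q, h)) [] \<in> Acc \<longleftrightarrow> [] \<in> lang p \<and> [] \<in> lang q \<and> h = x"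
      by (auto simp: Acc_def)
    moreover have "[] = padded_pair u v \<longleftrightarrow> u = [] \<and> v = []" for u v :: "'a list"
      using padded_pair_Nil_iff by metis
    ultimately show ?case
      using Nil D'c[of h] by auto
  next
    case (Cons ab z)
    obtain a b where ab: "ab = (a, b)" by fastforce
    have X_ab: "a \<in> insert None (Some ` X)" "b \<in> insert None (Some ` X)" "(a, b) \<noteq> (None, None)"
      and z: "z \<in> lists (padded_alphabet X)"
      using Cons.prems(1) by (auto simp: ab padded_alphabet_def)
    define h' where "h' = inv (opt_val a) \<otimes> h \<otimes> opt_val b"
    have hc: "h \<in> carrier G"
      using D'c Cons.prems(2) by blast
    show ?case (is "_ \<longleftrightarrow> ?R")
    proof
      assume acc: "foldl T (Some (p, q, h)) (ab # z) \<in> Acc"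
      have "T (Some (p, q, h)) ab \<noteq> None"
      proof
        assume "T (Some (p, q, h)) ab = None"
        then have "None \<in> Acc"
          using acc fail by simp
        then show False
          by (simp add: Acc_def)
      qed
      then obtain p' q' where pq: "step p a = Some p'" "step q b = Some q'" "h' \<in> D'"
        "T (Some (p, q, h)) ab = Some (p', q', h')"
        by (auto simp: T_def ab h'_def Let_def split: option.splits if_splits)
      then have "foldl T (Some (p', q', h')) z \<in> Acc"
        using acc by simp
      then obtain u' v' where u'v': "u' \<in> lang p'" "v' \<in> lang q'" "z = padded_pair u' v'"
        "inv (word_prod G u') \<otimes> h' \<otimes> word_prod G v' = x"
        "\<And>i. inv (word_prod G (take i u')) \<otimes> h' \<otimes> word_prod G (take i v') \<in> D'"
        using Cons.IH[OF z pq(3)] by blast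
      obtain u v where u: "u \<in> lang p" "opt_hd u = a" "tl u = u'"
        and v: "v \<in> lang q" "opt_hd v = b" "tl v = v'"
        using step_lang pq u'v' X_ab by meson
      have "(a, b) # z = padded_pair u v"
        using u v X_ab u'v'(3) by (auto simp: padded_pair_Cons_iff eq_commute[of "_ # _"])
      moreover have "inv (word_prod G (take i u)) \<otimes> h \<otimes> word_prod G (take i v) \<in> D'" for i
        using shift[OF lang_c[OF u(1)] lang_c[OF v(1)] hc] u v u'v'(5) Cons.prems(2) hc
        by (cases i) (simp_all add: h'_def)
      moreover have "inv (word_prod G u) \<otimes> h \<otimes> word_prod G v = x"
        using shift_all[OF lang_c[OF u(1)] lang_c[OF v(1)] hc] u v u'v'(4) by (simp add: h'_def)
      ultimately show ?R
        using u(1) v(1) ab by blast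
    next
      assume ?R
      then obtain u v where u: "u \<in> lang p" and v: "v \<in> lang q" and uv: "(a, b) # z = padded_pair u v"
        and x: "inv (word_prod G u) \<otimes> h \<otimes> word_prod G v = x"
        and i: "\<And>i. inv (word_prod G (take i u)) \<otimes> h \<otimes> word_prod G (take i v) \<in> D'"
        using ab by blast
      have hd: "a = opt_hd u" "b = opt_hd v" and z': "z = padded_pair (tl u) (tl v)"
        using uv[symmetric] by (auto simp: padded_pair_Cons_iff)
      obtain p' q' where pq: "step p a = Some p'" "step q b = Some q'"
        "tl u \<in> lang p'" "tl v \<in> lang q'"
        using lang_step u v hd by metis
      note sh = shift[OF lang_c[OF u] lang_c[OF v] hc, folded hd, folded h'_def]
      have h'c: "h' \<in> carrier G"
        using hc opt_val_closed[OF X] X_ab by (simp add: h'_def)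
      have i': "inv (word_prod G (take i (tl u))) \<otimes> h' \<otimes> word_prod G (take i (tl v)) \<in> D'" for i
        using i[of "Suc i"] sh by simp
      \<comment> \<open>The empty prefix of the tails has difference \<open>h'\<close> itself, so
        the run does not die at this symbol.\<close>
      have h'D: "h' \<in> D'"
        using i'[of 0] h'c by simp
      have "foldl T (Some (p', q', h')) z \<in> Acc"
        unfolding Cons.IH[OF z h'D] using pq z' i' x
          shift_all[OF lang_c[OF u] lang_c[OF v] hc, folded hd, folded h'_def] by auto
      then show "foldl T (Some (p, q, h)) (ab # z) \<in> Acc"
        using pq h'D by (simp add: T_def ab flip: h'_def)
    qed
  qed
  show ?thesis
  proof (rule regular_languageI[of _ S "Some (Some q\<^sub>0, Some q\<^sub>0, \<one>)" T _ Acc])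
    show "finite (padded_alphabet X)"
      using Q(1) by (simp add: padded_alphabet_def)
    show "finite S"
      using Q(2) D(1) by (simp add: S_def D'_def)
    show "Some (Some q\<^sub>0, Some q\<^sub>0, \<one>) \<in> S"
      using Q(3) by (simp add: S_def D'_def)
    have step_Q: "p' \<in> insert None (Some ` Q)"
      if "step p a = Some p'" "p \<in> insert None (Some ` Q)" "a \<in> insert None (Some ` X)" for p a p'
      using that Q(5) by (auto simp: step_def split: option.splits if_splits)
    show "T s ab \<in> S" if "s \<in> S" "ab \<in> padded_alphabet X" for s ab
    proof (cases "T s ab")
      case (Some s')
      then obtain p q h where s: "s = Some (p, q, h)"
        by (cases s) (auto simp: T_def)
      obtain p' q' h' where s': "step p (fst ab) = Some p'" "step q (snd ab) = Some q'" "h' \<in> D'"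
        "s' = (p', q', h')"
        using Some by (auto simp: T_def s Let_def split: option.splits if_splits)
      moreover have "p \<in> insert None (Some ` Q)" "q \<in> insert None (Some ` Q)"
        using that(1) by (auto simp: S_def s)
      moreover have "fst ab \<in> insert None (Some ` X)" "snd ab \<in> insert None (Some ` X)"
        using that(2) by (auto simp: padded_alphabet_def)
      ultimately have "p' \<in> insert None (Some ` Q)" "q' \<in> insert None (Some ` Q)"
        using step_Q by blast+
      then show ?thesis
        using Some s' by (simp add: S_def)
    qed (simp add: S_def)
    have lang0: "lang (Some q\<^sub>0) = L"
      by (simp add: lang_def L_eq)
    have eq: "inv (word_prod G u) \<otimes> \<one> \<otimes> word_prod G v = x \<longleftrightarrow> word_prod G u \<otimes> x = word_prod G v"
      if "u \<in> L" "v \<in> L" for u v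
    proof -
      have "word_prod G u \<in> carrier G" "word_prod G v \<in> carrier G"
        using that lang_c[of _ "Some q\<^sub>0"] lang0 by simp_all
      then show ?thesis
        using \<open>x \<in> carrier G\<close> by (metis inv_closed inv_solve_left' r_one)
    qed
    have near': "inv (word_prod G (take i u)) \<otimes> \<one> \<otimes> word_prod G (take i v) \<in> D'"
      if "u \<in> L" "v \<in> L" "word_prod G u \<otimes> x = word_prod G v" for u v i
    proof -
      have "set u \<subseteq> carrier G"
        using that lang_c[of u "Some q\<^sub>0"] lang0 by simp
      then have "word_prod G (take i u) \<in> carrier G"
        using set_take_subset[of i u] by (intro word_prod_closed) blast
      then show ?thesis
        using near[OF that] by (simp add: D'_def)
    qed
    have run0: "foldl T (Some (Some q\<^sub>0, Some q\<^sub>0, \<one>)) z \<in> Acc \<longleftrightarrow>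
        (\<exists>u \<in> L. \<exists>v \<in> L. z = padded_pair u v \<and> word_prod G u \<otimes> x = word_prod G v)"
      if "z \<in> lists (padded_alphabet X)" for z
      unfolding run[OF that, of \<one>, unfolded D'_def, OF insertI1, folded D'_def] lang0
      using eq near' by blast
    show "{padded_pair u v | u v. u \<in> L \<and> v \<in> L \<and> word_prod G u \<otimes> x = word_prod G v} =
        {z \<in> lists (padded_alphabet X). foldl T (Some (Some q\<^sub>0, Some q\<^sub>0, \<one>)) z \<in> Acc}"
    proof (intro equalityI subsetI)
      fix z assume "z \<in> {padded_pair u v | u v. u \<in> L \<and> v \<in> L \<and> word_prod G u \<otimes> x = word_prod G v}"
      then obtain u v where uv: "z = padded_pair u v" "u \<in> L" "v \<in> L"
        "word_prod G u \<otimes> x = word_prod G v" by blast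
      moreover have "z \<in> lists (padded_alphabet X)"
        unfolding uv(1) using uv(2,3) by (intro padded_pair_lists) (simp_all add: L_eq)
      ultimately show "z \<in> {z \<in> lists (padded_alphabet X).
          foldl T (Some (Some q\<^sub>0, Some q\<^sub>0, \<one>)) z \<in> Acc}"
        using run0 by blast
    qed (use run0 in blast)
  qed
qed

end

section \<open>The lattice order\<close>

text \<open>\<open>P\<close> is the positive cone. The two conjugation assumptions say that
  \<open>\<Delta>\<close> normalises it, and \<open>Delta_cofinal\<close> moves every element into
  \<open>P\<close> by a power of \<open>\<Delta>\<close>. Meets are assumed inside \<open>P\<close>
  only and are extended to the group later.\<close>

locale garside_group = group G for G :: "('g, 'n) monoid_scheme" (structure) +
  fixes P :: "'g set" and \<Delta> :: 'g
  assumes P_subset: "P \<subseteq> carrier G"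
    and one_P [simp]: "\<one> \<in> P"
    and mult_P: "\<lbrakk>x \<in> P; y \<in> P\<rbrakk> \<Longrightarrow> x \<otimes> y \<in> P"
    and P_units: "\<lbrakk>x \<in> P; inv x \<in> P\<rbrakk> \<Longrightarrow> x = \<one>"
    and Delta_P [simp]: "\<Delta> \<in> P"
    and conj_P: "x \<in> P \<Longrightarrow> \<Delta> \<otimes> x \<otimes> inv \<Delta> \<in> P"
    and conj_inv_P: "x \<in> P \<Longrightarrow> inv \<Delta> \<otimes> x \<otimes> \<Delta> \<in> P"
    and finite_simples: "finite {s \<in> P. inv s \<otimes> \<Delta> \<in> P}"
    and Delta_cofinal: "g \<in> carrier G \<Longrightarrow> \<exists>n::nat. \<Delta> [^] n \<otimes> g \<in> P"
    and P_meet: "\<lbrakk>x \<in> P; y \<in> P\<rbrakk> \<Longrightarrow> \<exists>m \<in> P. inv m \<otimes> x \<in> P \<and> inv m \<otimes> y \<in> P \<and>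
      (\<forall>z \<in> P. inv z \<otimes> x \<in> P \<longrightarrow> inv z \<otimes> y \<in> P \<longrightarrow> inv z \<otimes> m \<in> P)"
begin

section \<open>Elementary properties of the order\<close>

lemma P_carrier [simp]: "x \<in> P \<Longrightarrow> x \<in> carrier G"
  using P_subset by blast

lemma Delta_carrier [simp]: "\<Delta> \<in> carrier G"
  by simp

lemma inv_mult_cancel [simp]:
  "\<lbrakk>x \<in> carrier G; y \<in> carrier G\<rbrakk> \<Longrightarrow> inv x \<otimes> (x \<otimes> y) = y"
  "\<lbrakk>x \<in> carrier G; y \<in> carrier G\<rbrakk> \<Longrightarrow> x \<otimes> (inv x \<otimes> y) = y"
  by (simp_all flip: m_assoc)

lemma pow_P [simp]: "x \<in> P \<Longrightarrow> x [^] (n::nat) \<in> P"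
  by (induction n) (auto simp: mult_P)

lemma conj_pow_P: "x \<in> P \<Longrightarrow> \<Delta> [^] (n::nat) \<otimes> x \<otimes> inv (\<Delta> [^] n) \<in> P"
proof (induction n arbitrary: x)
  case (Suc n)
  then show ?case
    using Suc.IH[OF conj_P[of x]] by (simp add: inv_mult_group m_assoc)
qed auto

lemma conj_inv_pow_P: "x \<in> P \<Longrightarrow> inv (\<Delta> [^] (n::nat)) \<otimes> x \<otimes> \<Delta> [^] n \<in> P"
proof (induction n)
  case (Suc n)
  then show ?case
    using conj_inv_P[of "inv (\<Delta> [^] n) \<otimes> x \<otimes> \<Delta> [^] n"]
    by (simp add: inv_mult_group m_assoc)
qed auto

definition le :: "'g \<Rightarrow> 'g \<Rightarrow> bool" (infix "\<preceq>" 50) where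
  "x \<preceq> y \<longleftrightarrow> inv x \<otimes> y \<in> P"

lemma one_le_iff: "x \<in> carrier G \<Longrightarrow> \<one> \<preceq> x \<longleftrightarrow> x \<in> P"
  by (simp add: le_def)

lemma le_refl [simp]: "x \<in> carrier G \<Longrightarrow> x \<preceq> x"
  by (simp add: le_def)

lemma le_trans:
  assumes "x \<preceq> y" "y \<preceq> z" "x \<in> carrier G" "y \<in> carrier G" "z \<in> carrier G"
  shows "x \<preceq> z"
proof -
  have "(inv x \<otimes> y) \<otimes> (inv y \<otimes> z) \<in> P"
    using assms by (simp only: le_def mult_P)
  then show ?thesis
    using assms by (simp add: le_def m_assoc)
qed

lemma le_antisym:
  assumes "x \<preceq> y" "y \<preceq> x" "x \<in> carrier G" "y \<in> carrier G"
  shows "x = y"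
proof -
  have "inv (inv x \<otimes> y) \<in> P" "inv x \<otimes> y \<in> P"
    using assms by (simp_all add: le_def inv_mult_group)
  then have "inv x \<otimes> y = \<one>"
    using P_units by blast
  then show ?thesis
    using assms by (metis inv_closed inv_equality inv_inv)
qed

lemma le_mult_left_iff [simp]:
  "\<lbrakk>x \<in> carrier G; y \<in> carrier G; z \<in> carrier G\<rbrakk> \<Longrightarrow> z \<otimes> x \<preceq> z \<otimes> y \<longleftrightarrow> x \<preceq> y"
  by (simp add: le_def inv_mult_group m_assoc)

text \<open>The quotient of the right translates is the conjugate of
  \<open>inv x \<otimes> y\<close> by \<open>\<Delta> [^] n\<close>, and conjugation by powers of
  \<open>\<Delta>\<close> preserves \<open>P\<close> in both directions.\<close>

lemma le_mult_pow_iff [simp]: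
  assumes "x \<in> carrier G" "y \<in> carrier G"
  shows "x \<otimes> \<Delta> [^] (n::nat) \<preceq> y \<otimes> \<Delta> [^] n \<longleftrightarrow> x \<preceq> y"
proof
  assume "x \<otimes> \<Delta> [^] n \<preceq> y \<otimes> \<Delta> [^] n"
  from conj_pow_P[OF this[unfolded le_def], of n] show "x \<preceq> y"
    using assms by (simp add: le_def inv_mult_group m_assoc)
next
  assume "x \<preceq> y"
  from conj_inv_pow_P[OF this[unfolded le_def], of n]
  show "x \<otimes> \<Delta> [^] n \<preceq> y \<otimes> \<Delta> [^] n"
    using assms by (simp add: le_def inv_mult_group m_assoc)
qed

lemma le_mult_Delta_iff [simp]:
  assumes "x \<in> carrier G" "y \<in> carrier G"
  shows "x \<otimes> \<Delta> \<preceq> y \<otimes> \<Delta> \<longleftrightarrow> x \<preceq> y"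
  using le_mult_pow_iff[of x y 1] assms by simp

lemma le_mult_P [simp]: "\<lbrakk>x \<in> carrier G; p \<in> P\<rbrakk> \<Longrightarrow> x \<preceq> x \<otimes> p"
  by (simp add: le_def)

lemma le_mult_pow_mono:
  assumes "x \<in> carrier G" "(m::nat) \<le> n"
  shows "x \<otimes> \<Delta> [^] m \<preceq> x \<otimes> \<Delta> [^] n"
proof -
  have "\<Delta> [^] n = \<Delta> [^] m \<otimes> \<Delta> [^] (n - m)"
    using assms(2) by (simp add: nat_pow_mult)
  then show ?thesis
    using assms by simp
qed

lemma pow_mono: "(m::nat) \<le> n \<Longrightarrow> \<Delta> [^] m \<preceq> \<Delta> [^] n"
  using le_mult_pow_mono[of \<one> m n] by simp

text \<open>A power \<open>c\<close> of \<open>\<Delta>\<close> moves both elements into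
  \<open>P\<close>, where \<open>P_meet\<close> yields \<open>m\<close>; the candidate is
  \<open>inv c \<otimes> m\<close>. Since \<open>m\<close> is greatest only among lower bounds in
  \<open>P\<close>, other lower bounds need a second translation.\<close>

lemma ex_meet:
  assumes "x \<in> carrier G" "y \<in> carrier G"
  shows "\<exists>m \<in> carrier G. m \<preceq> x \<and> m \<preceq> y \<and>
    (\<forall>z \<in> carrier G. z \<preceq> x \<longrightarrow> z \<preceq> y \<longrightarrow> z \<preceq> m)"
proof -
  have mono: "\<Delta> [^] n \<otimes> g \<in> P" if "\<Delta> [^] (m::nat) \<otimes> g \<in> P" "m \<le> n" "g \<in> carrier G"
    for m n :: nat and g
  proof -
    have "\<Delta> [^] (n - m) \<otimes> (\<Delta> [^] m \<otimes> g) \<in> P"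
      using that by (simp add: mult_P)
    then show ?thesis
      using that by (simp add: nat_pow_mult flip: m_assoc)
  qed
  obtain i j :: nat where ij: "\<Delta> [^] i \<otimes> x \<in> P" "\<Delta> [^] j \<otimes> y \<in> P"
    using assms Delta_cofinal by blast
  define c where "c = \<Delta> [^] max i j"
  have c: "c \<in> P" by (simp add: c_def)
  have cP: "c \<otimes> x \<in> P" "c \<otimes> y \<in> P"
    using ij assms mono unfolding c_def by (metis max.cobounded1 max.cobounded2)+
  then obtain m where m: "m \<in> P" "m \<preceq> c \<otimes> x" "m \<preceq> c \<otimes> y"
    and glb: "\<And>z. \<lbrakk>z \<in> P; z \<preceq> c \<otimes> x; z \<preceq> c \<otimes> y\<rbrakk> \<Longrightarrow> z \<preceq> m"
    using P_meet unfolding le_def by metis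
  define m' where "m' = inv c \<otimes> m"
  have m': "m' \<in> carrier G" "c \<otimes> m' = m"
    using m c by (simp_all add: m'_def)
  have "m' \<preceq> x" "m' \<preceq> y"
    using m m' c assms le_mult_left_iff[of m' _ c] by (auto simp: m'_def)
  moreover have "z \<preceq> m'" if z: "z \<in> carrier G" "z \<preceq> x" "z \<preceq> y" for z
  proof -
    \<comment> \<open>The second translation \<open>d\<close> also brings the lower bound into
      \<open>P\<close>; the meet \<open>l\<close> formed there is then compared with
      \<open>d \<otimes> m\<close>.\<close>
    obtain k :: nat where k: "\<Delta> [^] k \<otimes> (c \<otimes> z) \<in> P"
      using Delta_cofinal z c by fastforce
    define d where "d = \<Delta> [^] k"
    have d: "d \<in> P" "d \<otimes> (c \<otimes> z) \<in> P"
      using k by (auto simp: d_def)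
    obtain l where l: "l \<in> P" "l \<preceq> d \<otimes> (c \<otimes> x)" "l \<preceq> d \<otimes> (c \<otimes> y)"
      and lglb: "\<And>z. \<lbrakk>z \<in> P; z \<preceq> d \<otimes> (c \<otimes> x); z \<preceq> d \<otimes> (c \<otimes> y)\<rbrakk> \<Longrightarrow> z \<preceq> l"
      using P_meet[of "d \<otimes> (c \<otimes> x)" "d \<otimes> (c \<otimes> y)"] d cP unfolding le_def by (auto simp: mult_P)
    have "d \<otimes> m \<preceq> l"
      using lglb[of "d \<otimes> m"] d m cP by (simp add: mult_P)
    then have p: "inv (d \<otimes> m) \<otimes> l \<in> P"
      by (simp add: le_def)
    \<comment> \<open>This factorisation puts \<open>inv d \<otimes> l\<close> into
      \<open>P\<close>, as \<open>glb\<close> requires.\<close>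
    have dl: "inv d \<otimes> l = m \<otimes> (inv (d \<otimes> m) \<otimes> l)"
      using d m l by (simp add: inv_mult_group m_assoc)
    have dlP: "inv d \<otimes> l \<in> P"
      unfolding dl using m p by (simp add: mult_P)
    have "inv d \<otimes> l \<preceq> m"
    proof (rule glb[OF dlP])
      show "inv d \<otimes> l \<preceq> c \<otimes> x"
        using l d cP le_mult_left_iff[of "inv d \<otimes> l" "c \<otimes> x" d] by simp
      show "inv d \<otimes> l \<preceq> c \<otimes> y"
        using l d cP le_mult_left_iff[of "inv d \<otimes> l" "c \<otimes> y" d] by simp
    qed
    moreover have "c \<otimes> z \<preceq> inv d \<otimes> l"
      using lglb[of "d \<otimes> (c \<otimes> z)"] d z c l assms
        le_mult_left_iff[of "c \<otimes> z" "inv d \<otimes> l" d] by simp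
    ultimately have "c \<otimes> z \<preceq> m"
      using le_trans z c m dlP by (meson P_carrier m_closed)
    then show "z \<preceq> m'"
      using le_mult_left_iff[of z m' c, unfolded m'] z c m' by simp
  qed
  ultimately show ?thesis
    using m' by blast
qed

section \<open>Meets in the group and their translation\<close>

definition gmeet :: "'g \<Rightarrow> 'g \<Rightarrow> 'g" (infixl "\<curlywedge>" 65) where
  "x \<curlywedge> y = (SOME m. m \<in> carrier G \<and> m \<preceq> x \<and> m \<preceq> y \<and>
    (\<forall>z \<in> carrier G. z \<preceq> x \<longrightarrow> z \<preceq> y \<longrightarrow> z \<preceq> m))"

lemma
  assumes "x \<in> carrier G" "y \<in> carrier G"
  shows gmeet_closed [simp]: "x \<curlywedge> y \<in> carrier G"
    and gmeet_le1: "x \<curlywedge> y \<preceq> x"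
    and gmeet_le2: "x \<curlywedge> y \<preceq> y"
    and gmeet_greatest: "\<lbrakk>z \<preceq> x; z \<preceq> y; z \<in> carrier G\<rbrakk> \<Longrightarrow> z \<preceq> x \<curlywedge> y"
proof -
  have "\<exists>m. m \<in> carrier G \<and> m \<preceq> x \<and> m \<preceq> y \<and>
      (\<forall>z \<in> carrier G. z \<preceq> x \<longrightarrow> z \<preceq> y \<longrightarrow> z \<preceq> m)"
    using ex_meet[OF assms] by blast
  from someI_ex[OF this]
  show "x \<curlywedge> y \<in> carrier G" "x \<curlywedge> y \<preceq> x" "x \<curlywedge> y \<preceq> y"
    "\<lbrakk>z \<preceq> x; z \<preceq> y; z \<in> carrier G\<rbrakk> \<Longrightarrow> z \<preceq> x \<curlywedge> y"
    unfolding gmeet_def by blast+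
qed

lemma le_gmeet_iff:
  assumes "x \<in> carrier G" "y \<in> carrier G" "z \<in> carrier G"
  shows "z \<preceq> x \<curlywedge> y \<longleftrightarrow> z \<preceq> x \<and> z \<preceq> y"
  using assms gmeet_le1 gmeet_le2 gmeet_greatest le_trans gmeet_closed by meson

lemma gmeet_eqI:
  assumes "x \<in> carrier G" "y \<in> carrier G" "m \<in> carrier G"
    and "\<And>z. z \<in> carrier G \<Longrightarrow> z \<preceq> m \<longleftrightarrow> z \<preceq> x \<and> z \<preceq> y"
  shows "m = x \<curlywedge> y"
proof (rule le_antisym)
  show "m \<preceq> x \<curlywedge> y"
    using assms by (simp add: le_gmeet_iff flip: assms(4))
  show "x \<curlywedge> y \<preceq> m"
    using assms gmeet_le1 gmeet_le2 by (simp add: assms(4))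
qed (use assms in auto)

lemma gmeet_absorb:
  assumes "x \<in> carrier G" "y \<in> carrier G" "z \<in> carrier G" "x \<preceq> z"
  shows "x \<curlywedge> (y \<curlywedge> z) = x \<curlywedge> y"
proof (rule gmeet_eqI)
  fix u assume "u \<in> carrier G"
  then show "u \<preceq> x \<curlywedge> (y \<curlywedge> z) \<longleftrightarrow> u \<preceq> x \<and> u \<preceq> y"
    using assms le_trans[of u x z] by (auto simp: le_gmeet_iff)
qed (use assms in auto)

lemma gmeet_mult_left:
  assumes "x \<in> carrier G" "y \<in> carrier G" "z \<in> carrier G"
  shows "z \<otimes> (x \<curlywedge> y) = z \<otimes> x \<curlywedge> z \<otimes> y"
proof (rule gmeet_eqI)
  fix u assume u: "u \<in> carrier G"
  have "u \<preceq> z \<otimes> v \<longleftrightarrow> inv z \<otimes> u \<preceq> v" if "v \<in> carrier G" for v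
    using that u assms le_mult_left_iff[of "inv z \<otimes> u" v z] by simp
  then show "u \<preceq> z \<otimes> (x \<curlywedge> y) \<longleftrightarrow> u \<preceq> z \<otimes> x \<and> u \<preceq> z \<otimes> y"
    using assms u by (simp add: le_gmeet_iff)
qed (use assms in auto)

lemma gmeet_mult_pow:
  assumes "x \<in> carrier G" "y \<in> carrier G"
  shows "(x \<curlywedge> y) \<otimes> \<Delta> [^] (n::nat) = x \<otimes> \<Delta> [^] n \<curlywedge> y \<otimes> \<Delta> [^] n"
proof (rule gmeet_eqI)
  fix u assume u: "u \<in> carrier G"
  have "u \<preceq> v \<otimes> \<Delta> [^] n \<longleftrightarrow> u \<otimes> inv (\<Delta> [^] n) \<preceq> v" if "v \<in> carrier G" for v
    using that u assms le_mult_pow_iff[of "u \<otimes> inv (\<Delta> [^] n)" v n] by (simp add: m_assoc)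
  then show "u \<preceq> (x \<curlywedge> y) \<otimes> \<Delta> [^] n \<longleftrightarrow> u \<preceq> x \<otimes> \<Delta> [^] n \<and> u \<preceq> y \<otimes> \<Delta> [^] n"
    using assms u by (simp add: le_gmeet_iff)
qed (use assms in auto)

subsection \<open>Normal words\<close>

text \<open>The power of \<open>\<Delta>\<close> that brings a letter into the interval from
  \<open>\<one>\<close> to \<open>\<Delta>\<close>.\<close>

definition neg :: "'g \<Rightarrow> nat" where
  "neg x = (if x \<in> P then 0 else 1)"

lemma neg_simps [simp]: "x \<in> P \<Longrightarrow> neg x = 0" "x \<notin> P \<Longrightarrow> neg x = 1"
  by (simp_all add: neg_def)

text \<open>The identity is kept because rewriting two letters may produce it;
  \<open>alphabet\<close> leaves it out.\<close>

definition letters :: "'g set" where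
  "letters = {x \<in> carrier G. x \<in> P \<and> x \<preceq> \<Delta> \<or> x \<otimes> \<Delta> \<in> P \<and> x \<preceq> \<one>}"

definition alphabet :: "'g set" where
  "alphabet = letters - {\<one>}"

lemma letters_carrier: "x \<in> letters \<Longrightarrow> x \<in> carrier G"
  by (simp add: letters_def)

lemma letters_one [simp]: "\<one> \<in> letters"
  by (simp add: letters_def one_le_iff le_def)

lemma alphabet_letters [simp]: "x \<in> alphabet \<Longrightarrow> x \<in> letters"
  by (simp add: alphabet_def)

lemma letter_bounds:
  assumes "x \<in> letters"
  shows "\<one> \<preceq> x \<otimes> \<Delta> [^] neg x" "x \<otimes> \<Delta> [^] neg x \<preceq> \<Delta>"
proof -
  have "x \<otimes> \<Delta> \<preceq> \<Delta>" if "x \<preceq> \<one>"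
    using that le_mult_Delta_iff[of x \<one>] letters_carrier[OF assms] by simp
  moreover have "x \<preceq> \<Delta>" if "x \<preceq> \<one>"
    using that le_trans[of x \<one> \<Delta>] letters_carrier[OF assms] by (simp add: one_le_iff)
  ultimately show "\<one> \<preceq> x \<otimes> \<Delta> [^] neg x" "x \<otimes> \<Delta> [^] neg x \<preceq> \<Delta>"
    using assms by (auto simp: letters_def one_le_iff neg_def)
qed

text \<open>The exponent \<open>e\<close> may differ from \<open>neg x\<close>: the identity
  satisfies the bounds for both values, and after a rewriting the sign need not be known.\<close>

lemma lettersI:
  assumes "x \<in> carrier G" "e \<le> 1" "\<one> \<preceq> x \<otimes> \<Delta> [^] (e::nat)" "x \<otimes> \<Delta> [^] e \<preceq> \<Delta>"
  shows "x \<in> letters"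
proof (cases "e = 0")
  case False
  then have "e = 1" using assms by simp
  then have "x \<preceq> \<one>"
    using assms le_mult_Delta_iff[of x \<one>] by simp
  then show ?thesis
    using assms \<open>e = 1\<close> by (auto simp: letters_def one_le_iff)
qed (use assms in \<open>auto simp: letters_def one_le_iff\<close>)

declare letters_carrier [simp]

text \<open>Left greediness for mixed signs: once \<open>x \<otimes> y\<close> is made positive by a
  power of \<open>\<Delta>\<close>, its meet with \<open>\<Delta>\<close> is already accounted for
  by \<open>x\<close>, so nothing more can be moved from \<open>y\<close> into \<open>x\<close>. The
  first conjunct puts positive letters before negative ones.\<close>

definition normal_pair :: "'g \<Rightarrow> 'g \<Rightarrow> bool" where
  "normal_pair x y \<longleftrightarrow> (y \<in> P \<longrightarrow> x \<in> P) \<and>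
    x \<otimes> \<Delta> [^] neg x = \<Delta> \<curlywedge> x \<otimes> y \<otimes> \<Delta> [^] (neg y + neg x)"

definition normal_word :: "'g list \<Rightarrow> bool" where
  "normal_word w \<longleftrightarrow> w \<in> lists alphabet \<and> successively normal_pair w"

definition npos :: "'g list \<Rightarrow> nat" where
  "npos w = length (filter (\<lambda>x. x \<in> P) w)"

definition nneg :: "'g list \<Rightarrow> nat" where
  "nneg w = length (filter (\<lambda>x. x \<notin> P) w)"

lemma npos_simps [simp]:
  "npos [] = 0" "npos (x # w) = (if x \<in> P then Suc (npos w) else npos w)"
  "npos (u @ v) = npos u + npos v"
  by (simp_all add: npos_def)

lemma nneg_simps [simp]:
  "nneg [] = 0" "nneg (x # w) = nneg w + neg x" "nneg (u @ v) = nneg u + nneg v"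
  by (simp_all add: nneg_def neg_def)

lemma npos_nneg: "npos w + nneg w = length w"
  by (induction w) (auto simp: neg_def)

lemma lists_alphabet_carrier: "w \<in> lists alphabet \<Longrightarrow> set w \<subseteq> carrier G"
  by auto

lemma normal_word_Nil [simp]: "normal_word []"
  by (simp add: normal_word_def)

lemma normal_word_Cons:
  "normal_word (x # w) \<longleftrightarrow> x \<in> alphabet \<and> normal_word w \<and> (w = [] \<or> normal_pair x (hd w))"
  by (cases w) (auto simp: normal_word_def)

lemma normal_word_carrier [simp]: "normal_word w \<Longrightarrow> word_prod G w \<in> carrier G"
  by (simp add: normal_word_def lists_alphabet_carrier)

lemma normal_word_append:
  "normal_word (u @ v) \<Longrightarrow> normal_word u \<and> normal_word v"
  by (auto simp: normal_word_def successively_append_iff)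

lemma normal_word_npos_eq_0: "\<lbrakk>normal_word (x # w); x \<notin> P\<rbrakk> \<Longrightarrow> npos w = 0"
proof (induction w arbitrary: x)
  case (Cons y w)
  then have "y \<notin> P" "normal_word (y # w)"
    by (simp_all add: normal_word_Cons[of x] normal_pair_def)
  then show ?case
    using Cons.IH by simp
qed simp

lemma npos_take: "normal_word w \<Longrightarrow> npos (take i w) = min i (npos w)"
proof (induction w arbitrary: i)
  case (Cons x w)
  have "npos w = 0" if "x \<notin> P"
    using that Cons.prems normal_word_npos_eq_0 by blast
  then show ?case
    using Cons by (cases i) (auto simp: normal_word_Cons)
qed simp

text \<open>Positive letters come first, so for \<open>i\<close> up to the length of
  \<open>w\<close> the truncated difference \<open>i - npos w\<close> counts the negative letters
  among the first \<open>i\<close>.\<close>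

lemma nneg_drop:
  assumes "normal_word w"
  shows "nneg (drop i w) = nneg w - (i - npos w)"
proof -
  have "npos (take i w) + npos (drop i w) = npos w"
    by (metis append_take_drop_id npos_simps(3))
  then show ?thesis
    using npos_take[OF assms, of i] npos_nneg[of w] npos_nneg[of "drop i w"] by auto
qed

lemma normal_word_P: "normal_word w \<Longrightarrow> word_prod G w \<otimes> \<Delta> [^] nneg w \<in> P"
proof (induction w)
  case (Cons x w)
  then have "x \<otimes> \<Delta> [^] neg x \<in> P" and c: "x \<in> carrier G" "word_prod G w \<in> carrier G"
    using letter_bounds(1)[of x] by (auto simp: normal_word_Cons one_le_iff)
  moreover have "word_prod G w \<otimes> \<Delta> [^] nneg w \<in> P"
    using Cons by (simp add: normal_word_Cons)
  \<comment> \<open>The power of \<open>\<Delta>\<close> belonging to \<open>x\<close> is moved to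
    the end of the word; this conjugates the positive remainder, which stays positive.\<close>
  ultimately have "(x \<otimes> \<Delta> [^] neg x) \<otimes>
      (inv (\<Delta> [^] neg x) \<otimes> (word_prod G w \<otimes> \<Delta> [^] nneg w) \<otimes> \<Delta> [^] neg x) \<in> P"
    by (simp only: mult_P conj_inv_pow_P)
  also have "(x \<otimes> \<Delta> [^] neg x) \<otimes>
      (inv (\<Delta> [^] neg x) \<otimes> (word_prod G w \<otimes> \<Delta> [^] nneg w) \<otimes> \<Delta> [^] neg x) =
      x \<otimes> (word_prod G w \<otimes> (\<Delta> [^] nneg w \<otimes> \<Delta> [^] neg x))"
    using c by (simp add: m_assoc)
  also have "\<dots> = word_prod G (x # w) \<otimes> \<Delta> [^] nneg (x # w)"
    using c by (simp add: m_assoc nat_pow_mult)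
  finally show ?case .
qed simp

section \<open>Prefixes of normal words as meets\<close>

lemma pow_Delta_commute: "\<Delta> [^] (n::nat) \<otimes> \<Delta> = \<Delta> \<otimes> \<Delta> [^] n"
  using nat_pow_Suc2[of \<Delta> n] by simp

text \<open>Greediness is local. Write the meet \<open>m\<close> as
  \<open>x \<otimes> z \<otimes> \<Delta> [^] neg x\<close>. Then \<open>z\<close> lies below both
  \<open>\<Delta>\<close> and the positive rest \<open>h\<close>, hence by induction below the
  shifted letter \<open>y \<otimes> \<Delta> [^] neg y\<close>; so \<open>m\<close> is bounded in
  terms of the first two letters, and \<open>normal_pair\<close> applies.\<close>

lemma first_letter:
  "normal_word (x # w) \<Longrightarrow>
    x \<otimes> \<Delta> [^] neg x = \<Delta> \<curlywedge> word_prod G (x # w) \<otimes> \<Delta> [^] nneg (x # w)"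
proof (induction w arbitrary: x)
  case Nil
  then have x: "x \<in> letters" by (simp add: normal_word_Cons)
  then show ?case
    using letter_bounds(2)[OF x] gmeet_le2[of \<Delta> "x \<otimes> \<Delta> [^] neg x"]
      gmeet_greatest[of \<Delta> "x \<otimes> \<Delta> [^] neg x" "x \<otimes> \<Delta> [^] neg x"]
    by (intro le_antisym) (simp_all)
next
  case (Cons y w)
  define h where "h = word_prod G (y # w) \<otimes> \<Delta> [^] nneg (y # w)"
  have yw: "normal_word (y # w)" and xy: "normal_pair x y" and x: "x \<in> letters"
    and y: "y \<in> letters"
    using Cons.prems by (auto simp: normal_word_Cons)
  have hP: "h \<in> P"
    using normal_word_P[OF yw] by (simp add: h_def)
  have IH: "y \<otimes> \<Delta> [^] neg y = \<Delta> \<curlywedge> h"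
    using Cons.IH[OF yw] by (simp add: h_def)
  define e where "e = neg x"
  have xh: "word_prod G (x # y # w) \<otimes> \<Delta> [^] nneg (x # y # w) = x \<otimes> h \<otimes> \<Delta> [^] e"
    using x y yw normal_word_carrier[OF yw] unfolding h_def e_def
    by (simp add: m_assoc nat_pow_mult add.assoc)
  define m where "m = \<Delta> \<curlywedge> x \<otimes> h \<otimes> \<Delta> [^] e"
  have mc: "m \<in> carrier G" using x hP by (simp add: m_def)
  have "x \<otimes> \<Delta> [^] e \<preceq> x \<otimes> h \<otimes> \<Delta> [^] e"
    using x hP by simp
  then have xm: "x \<otimes> \<Delta> [^] e \<preceq> m"
    unfolding m_def using x hP letter_bounds(2)[OF x] by (simp add: le_gmeet_iff e_def)
  define z where "z = inv x \<otimes> m \<otimes> inv (\<Delta> [^] e)"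
  have zc: "z \<in> carrier G" and mz: "m = x \<otimes> z \<otimes> \<Delta> [^] e"
    using mc x by (simp_all add: z_def m_assoc)
  have mle: "m \<preceq> \<Delta>" "m \<preceq> x \<otimes> h \<otimes> \<Delta> [^] e"
    unfolding m_def using x hP gmeet_le1 gmeet_le2 by simp_all
  have "z \<preceq> h"
    using mle(2) mz zc x hP by simp
  \<comment> \<open>\<open>m \<preceq> \<Delta> \<preceq> x \<otimes> \<Delta> [^] e \<otimes>
    \<Delta>\<close>, because the shifted letter is positive; then \<open>x\<close> and the power
    are cancelled.\<close>
  moreover have "z \<preceq> \<Delta>"
  proof -
    have "\<Delta> \<preceq> x \<otimes> \<Delta> [^] e \<otimes> \<Delta>"
      using letter_bounds(1)[OF x] le_mult_Delta_iff[of \<one> "x \<otimes> \<Delta> [^] e"] x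
      by (simp add: e_def)
    then have "x \<otimes> z \<otimes> \<Delta> [^] e \<preceq> x \<otimes> \<Delta> [^] e \<otimes> \<Delta>"
      using mle(1) mz mc x le_trans[of m \<Delta> "x \<otimes> \<Delta> [^] e \<otimes> \<Delta>"] by simp
    also have "x \<otimes> \<Delta> [^] e \<otimes> \<Delta> = x \<otimes> \<Delta> \<otimes> \<Delta> [^] e"
      using x pow_Delta_commute by (simp add: m_assoc)
    finally show ?thesis
      using x zc by simp
  qed
  ultimately have "z \<preceq> y \<otimes> \<Delta> [^] neg y"
    unfolding IH using zc hP by (simp add: le_gmeet_iff)
  then have "m \<preceq> x \<otimes> (y \<otimes> \<Delta> [^] neg y) \<otimes> \<Delta> [^] e"
    unfolding mz using x y zc by (simp)
  also have "x \<otimes> (y \<otimes> \<Delta> [^] neg y) \<otimes> \<Delta> [^] e = x \<otimes> y \<otimes> \<Delta> [^] (neg y + e)"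
    using x y by (simp add: m_assoc nat_pow_mult)
  finally have "m \<preceq> x \<otimes> \<Delta> [^] e"
    using xy mle(1) mc x y gmeet_greatest[of \<Delta> "x \<otimes> y \<otimes> \<Delta> [^] (neg y + e)" m]
    unfolding normal_pair_def e_def by simp
  then have "x \<otimes> \<Delta> [^] e = m"
    using xm mc x by (intro le_antisym) auto
  then show ?case
    unfolding xh m_def e_def by simp
qed

text \<open>Induction on \<open>u\<close>. Multiplying by a new first letter \<open>x\<close> on the
  left gives the right first argument of the meet; \<open>first_letter\<close> rewrites the second
  one as a power of \<open>\<Delta>\<close> met with a bound that the first argument
  absorbs.\<close>

lemma normal_word_prefix:
  assumes "normal_word (u @ v)"
  shows "word_prod G u = word_prod G (u @ v) \<otimes> \<Delta> [^] nneg v \<curlywedge> \<Delta> [^] npos u"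
  using assms
proof (induction u)
  case Nil
  then have "\<one> \<preceq> word_prod G v \<otimes> \<Delta> [^] nneg v" and "word_prod G v \<in> carrier G"
    using normal_word_P[of v] by (simp_all add: one_le_iff)
  then show ?case
    using le_antisym gmeet_greatest gmeet_le2 by simp
next
  case (Cons x u)
  define g where "g = word_prod G (u @ v)"
  have uv: "normal_word (u @ v)" and x: "x \<in> letters"
    using Cons.prems by (simp_all add: normal_word_Cons)
  have g: "g \<in> carrier G" using normal_word_carrier[OF uv] by (simp add: g_def)
  let ?a = "nneg v" and ?b = "npos u"
  have IH: "word_prod G (x # u) = x \<otimes> g \<otimes> \<Delta> [^] ?a \<curlywedge> x \<otimes> \<Delta> [^] ?b"
    using Cons.IH[OF uv] g x by (simp add: gmeet_mult_left g_def m_assoc)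
  have fl: "x \<otimes> \<Delta> [^] neg x = \<Delta> \<curlywedge> x \<otimes> g \<otimes> \<Delta> [^] nneg (x # u @ v)"
    using first_letter[of x "u @ v"] Cons.prems by (simp add: g_def)
  \<comment> \<open>For positive \<open>x\<close>, \<open>fl\<close> is multiplied by
    \<open>\<Delta> [^] ?b\<close>. For negative \<open>x\<close> no positive letter follows, so
    \<open>?b\<close> is zero, and \<open>\<Delta>\<close> is cancelled from
    \<open>fl\<close>.\<close>
  have "x \<otimes> \<Delta> [^] ?b = \<Delta> [^] npos (x # u) \<curlywedge> x \<otimes> g \<otimes> \<Delta> [^] (nneg (u @ v) + ?b)"
  proof (cases "x \<in> P")
    case True
    then show ?thesis
      using fl gmeet_mult_pow[of \<Delta> "x \<otimes> g \<otimes> \<Delta> [^] nneg (u @ v)" ?b] g x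
      by (simp add: m_assoc nat_pow_mult pow_Delta_commute)
  next
    case False
    have "x \<otimes> \<Delta> = (\<one> \<curlywedge> x \<otimes> g \<otimes> \<Delta> [^] nneg (u @ v)) \<otimes> \<Delta>"
      using fl False gmeet_mult_pow[of \<one> "x \<otimes> g \<otimes> \<Delta> [^] nneg (u @ v)" 1] g x
      by (simp add: m_assoc)
    then have "x = \<one> \<curlywedge> x \<otimes> g \<otimes> \<Delta> [^] nneg (u @ v)"
      by (rule r_cancel) (use g x in simp_all)
    moreover have b: "?b = 0"
      using normal_word_npos_eq_0[of x "u @ v"] Cons.prems False by simp
    ultimately have "\<Delta> [^] npos (x # u) \<curlywedge> x \<otimes> g \<otimes> \<Delta> [^] (nneg (u @ v) + ?b) = x"
      using False by (simp only: npos_simps if_False add_0_right nat_pow_0)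
    then show ?thesis
      using b x by simp
  qed
  \<comment> \<open>Hence the extra argument of the meet is absorbed.\<close>
  moreover have "x \<otimes> g \<otimes> \<Delta> [^] ?a \<preceq> x \<otimes> g \<otimes> \<Delta> [^] (nneg (u @ v) + ?b)"
    using g x le_mult_pow_mono[of "x \<otimes> g" ?a "nneg (u @ v) + ?b"] by simp
  ultimately have "word_prod G (x # u) = x \<otimes> g \<otimes> \<Delta> [^] ?a \<curlywedge> \<Delta> [^] npos (x # u)"
    unfolding IH using g x gmeet_absorb by simp
  then show ?case
    by (simp add: g_def)
qed

text \<open>In a normal word all letters \<open>\<Delta>\<close> stand at the front and all letters
  \<open>inv \<Delta>\<close> at the end. Testing the first and the last letter therefore excludes
  either of them next to letters of the opposite sign anywhere in the word.\<close>

definition shortlex_normal :: "'g list \<Rightarrow> bool" where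
  "shortlex_normal w \<longleftrightarrow> normal_word w \<and> (w = [] \<or>
    \<not> (hd w = \<Delta> \<and> last w \<notin> P) \<and> \<not> (hd w \<in> P \<and> last w = inv \<Delta>))"

text \<open>On the right, \<open>w\<close> enters only through its element and its two counts;
  uniqueness and fellow travelling both rest on this.\<close>

lemma normal_word_take:
  assumes "normal_word w"
  shows "word_prod G (take i w) =
    word_prod G w \<otimes> \<Delta> [^] (nneg w - (i - npos w)) \<curlywedge> \<Delta> [^] min i (npos w)"
  using normal_word_prefix[of "take i w" "drop i w"] assms by (simp add: npos_take nneg_drop)

section \<open>Letter counts as minimal exponents, and uniqueness\<close>

lemma normal_word_le_pow_npos:
  assumes "normal_word w"
  shows "word_prod G w \<preceq> \<Delta> [^] npos w"
  using normal_word_prefix[of w "[]"] assms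
    gmeet_le2[of "word_prod G w" "\<Delta> [^] npos w"] by simp

lemma normal_word_nneg_eq_0:
  assumes "normal_word (u @ [x])" "x \<in> P"
  shows "nneg (u @ [x]) = 0"
  using npos_take[OF assms(1), of "length u"] npos_nneg[of u] assms(2) by simp

text \<open>If a smaller exponent sufficed, the prefix formula for the word without its last letter
  would force that letter to be \<open>\<one>\<close> or, when negative,
  \<open>inv \<Delta>\<close>. The former is not in the alphabet, the latter is forbidden after a
  positive first letter.\<close>

lemma shortlex_normal_le_pow_iff:
  assumes "shortlex_normal w"
  shows "word_prod G w \<preceq> \<Delta> [^] n \<longleftrightarrow> npos w \<le> n"
proof
  have w: "normal_word w" using assms by (simp add: shortlex_normal_def)
  note c = normal_word_carrier[OF w]
  show "word_prod G w \<preceq> \<Delta> [^] n" if "npos w \<le> n"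
    using le_trans[OF normal_word_le_pow_npos[OF w] pow_mono[OF that]] c by simp
  show "npos w \<le> n" if le: "word_prod G w \<preceq> \<Delta> [^] n"
  proof (rule ccontr)
    assume "\<not> npos w \<le> n"
    then obtain b where b: "npos w = Suc b" "n \<le> b"
      by (cases "npos w") auto
    have le: "word_prod G w \<preceq> \<Delta> [^] b"
      using le_trans[OF le pow_mono[OF b(2)]] c by simp
    obtain u x where ux: "w = u @ [x]"
      using b by (cases w rule: rev_cases) auto
    have x: "x \<in> alphabet" "x \<in> carrier G" and u: "word_prod G u \<in> carrier G"
      using w normal_word_append[of u "[x]"] by (auto simp: ux normal_word_Cons)
    have wux: "word_prod G w = word_prod G u \<otimes> x"
      using w x lists_alphabet_carrier[of u] by (simp add: ux word_prod_append normal_word_def)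
    show False
    proof (cases "x \<in> P")
      case True
      have "word_prod G w = word_prod G w \<curlywedge> \<Delta> [^] b"
        using le c by (intro le_antisym gmeet_greatest gmeet_le1) auto
      also have "\<dots> = word_prod G u"
        using normal_word_prefix[of u "[x]"] w b True by (simp add: ux)
      finally have "x = \<one>"
        using wux x u by simp
      then show False
        using x by (simp add: alphabet_def)
    next
      case False
      have "word_prod G w \<otimes> \<Delta> \<preceq> \<Delta> [^] npos w"
        using le c le_mult_Delta_iff[of "word_prod G w" "\<Delta> [^] b"] by (simp add: b)
      then have "word_prod G w \<otimes> \<Delta> = word_prod G w \<otimes> \<Delta> \<curlywedge> \<Delta> [^] npos w"
        using c by (intro le_antisym gmeet_greatest gmeet_le1) auto
      also have "\<dots> = word_prod G u"
        using normal_word_prefix[of u "[x]"] w b False by (simp add: ux)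
      finally have "word_prod G u \<otimes> (x \<otimes> \<Delta>) = word_prod G u"
        using wux x u by (simp add: m_assoc)
      then have "x \<otimes> \<Delta> = \<one>"
        using x u by simp
      then have "x = inv \<Delta>"
        using x inv_equality[of x \<Delta>] by simp
      moreover have "hd w \<in> P"
      proof (rule ccontr)
        assume "hd w \<notin> P"
        moreover have "w = hd w # tl w"
          using ux by simp
        ultimately have "npos w = 0"
          using normal_word_npos_eq_0[of "hd w" "tl w"] w npos_simps(2)[of "hd w" "tl w"] by simp
        then show False
          using b by simp
      qed
      ultimately show False
        using assms by (simp add: shortlex_normal_def ux)
    qed
  qed
qed

text \<open>Here the first letter \<open>x\<close> decides: a smaller exponent would give
  \<open>x \<otimes> \<Delta> [^] neg x = \<Delta>\<close>, so \<open>x\<close> is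
  \<open>\<Delta>\<close> or \<open>\<one>\<close>, and \<open>\<Delta>\<close> cannot begin a word
  whose last letter is negative.\<close>

lemma shortlex_normal_one_le_iff:
  assumes "shortlex_normal w"
  shows "\<one> \<preceq> word_prod G w \<otimes> \<Delta> [^] n \<longleftrightarrow> nneg w \<le> n"
proof
  have w: "normal_word w" using assms by (simp add: shortlex_normal_def)
  note c = normal_word_carrier[OF w]
  have one: "\<one> \<preceq> word_prod G w \<otimes> \<Delta> [^] nneg w"
    using normal_word_P[OF w] c by (simp add: one_le_iff)
  show "\<one> \<preceq> word_prod G w \<otimes> \<Delta> [^] n" if "nneg w \<le> n"
    using le_trans[OF one le_mult_pow_mono[OF c that]] c by simp
  show "nneg w \<le> n" if le: "\<one> \<preceq> word_prod G w \<otimes> \<Delta> [^] n"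
  proof (rule ccontr)
    assume "\<not> nneg w \<le> n"
    then obtain a where a: "nneg w = Suc a" "n \<le> a"
      by (cases "nneg w") auto
    have "\<one> \<preceq> word_prod G w \<otimes> \<Delta> [^] a"
      using le_trans[OF le le_mult_pow_mono[OF c a(2)]] c by simp
    then have "\<Delta> \<preceq> word_prod G w \<otimes> \<Delta> [^] nneg w"
      using c le_mult_Delta_iff[of \<one> "word_prod G w \<otimes> \<Delta> [^] a"]
      by (simp add: a m_assoc)
    then have "\<Delta> = \<Delta> \<curlywedge> word_prod G w \<otimes> \<Delta> [^] nneg w"
      using c by (intro le_antisym gmeet_greatest gmeet_le1) auto
    moreover obtain x v where xv: "w = x # v"
      using a by (cases w) auto
    ultimately have x\<Delta>: "x \<otimes> \<Delta> [^] neg x = \<Delta>"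
      using first_letter[of x v] w by simp
    have x: "x \<in> alphabet" "x \<in> carrier G"
      using w by (simp_all add: xv normal_word_Cons)
    show False
    proof (cases "x \<in> P")
      case True
      obtain u y where uy: "w = u @ [y]"
        using a by (cases w rule: rev_cases) auto
      then have "y \<notin> P"
        using normal_word_nneg_eq_0[of u y] w a by auto
      then show False
        using x\<Delta> True assms x xv uy by (cases v rule: rev_cases) (auto simp: shortlex_normal_def)
    next
      case False
      then have "x = \<one>"
        using x\<Delta> x by simp
      then show False
        using x by (simp add: alphabet_def)
    qed
  qed
qed

lemma word_eqI:
  assumes "length u = length v" "set u \<subseteq> carrier G" "set v \<subseteq> carrier G"
    and "\<And>i. word_prod G (take i u) = word_prod G (take i v)"
  shows "u = v"
proof (rule nth_equalityI)
  fix i assume i: "i < length u"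
  have t: "set (take i w) \<subseteq> carrier G" if "set w \<subseteq> carrier G" for w
    using that set_take_subset[of i w] by blast
  have n: "w ! i \<in> carrier G" if "i < length w" "set w \<subseteq> carrier G" for w
    using that nth_mem by blast
  have "word_prod G (take (Suc i) w) = word_prod G (take i w) \<otimes> w ! i"
    if "i < length w" "set w \<subseteq> carrier G" for w
    using that word_prod_append[of "take i w" "[w ! i]"] t[of w] n[of w]
    by (simp add: take_Suc_conv_app_nth)
  then have "word_prod G (take i u) \<otimes> u ! i = word_prod G (take i u) \<otimes> v ! i"
    using assms i by metis
  moreover have "u ! i \<in> carrier G" "v ! i \<in> carrier G"
    using assms i n by simp_all
  ultimately show "u ! i = v ! i"
    using l_cancel word_prod_closed[OF t] assms(2) by blast
qed (use assms in auto)

text \<open>As minimal exponents both counts are determined by the element, and then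
  \<open>normal_word_take\<close> determines every prefix product.\<close>

lemma shortlex_normal_unique:
  assumes "shortlex_normal u" "shortlex_normal v" "word_prod G u = word_prod G v"
  shows "u = v"
proof (rule word_eqI)
  have n: "normal_word u" "normal_word v"
    using assms by (simp_all add: shortlex_normal_def)
  have pos: "npos u = npos v"
    using shortlex_normal_le_pow_iff assms by (metis order_antisym order_refl)
  have neg: "nneg u = nneg v"
    using shortlex_normal_one_le_iff assms by (metis order_antisym order_refl)
  show "length u = length v"
    using pos neg npos_nneg by metis
  show "set u \<subseteq> carrier G" "set v \<subseteq> carrier G"
    using n by (simp_all add: normal_word_def lists_alphabet_carrier)
  show "word_prod G (take i u) = word_prod G (take i v)" for i
    using n normal_word_take pos neg assms(3) by simp
qed

section \<open>Finite intervals and generation\<close>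

lemma finite_interval: "finite {z \<in> P. z \<preceq> \<Delta> [^] (n::nat)}"
  and P_generated: "\<lbrakk>p \<in> P; p \<preceq> \<Delta> [^] (n::nat)\<rbrakk> \<Longrightarrow> \<exists>w \<in> lists letters. word_prod G w = p"
proof -
  \<comment> \<open>Splitting off the meet with \<open>\<Delta>\<close> lowers the exponent by one;
    both conclusions then follow by induction on \<open>n\<close>.\<close>
  have step: "\<exists>m \<in> P. \<exists>q \<in> P. m \<preceq> \<Delta> \<and> q \<preceq> \<Delta> [^] n \<and> p = m \<otimes> q"
    if p: "p \<in> P" "p \<preceq> \<Delta> [^] Suc n" for p and n :: nat
  proof (intro bexI conjI)
    let ?m = "\<Delta> \<curlywedge> p"
    have m: "?m \<in> carrier G" "?m \<preceq> \<Delta>" "?m \<preceq> p" "\<one> \<preceq> ?m"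
      using p gmeet_le1 gmeet_le2 by (simp_all add: le_gmeet_iff one_le_iff)
    show "?m \<in> P" "inv ?m \<otimes> p \<in> P" "?m \<preceq> \<Delta>"
      using m by (simp_all add: one_le_iff le_def[symmetric])
    show "p = ?m \<otimes> (inv ?m \<otimes> p)"
      using m p by simp
    have "p \<preceq> \<Delta> \<otimes> \<Delta> [^] n \<curlywedge> p \<otimes> \<Delta> [^] n"
      using p by (intro gmeet_greatest) (simp_all add: pow_Delta_commute)
    also have "\<dots> = ?m \<otimes> \<Delta> [^] n"
      using p by (simp add: gmeet_mult_pow)
    finally show "inv ?m \<otimes> p \<preceq> \<Delta> [^] n"
      using m p le_mult_left_iff[of "inv ?m \<otimes> p" "\<Delta> [^] n" ?m] by simp
  qed
  show "finite {z \<in> P. z \<preceq> \<Delta> [^] (n::nat)}"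
  proof (induction n)
    case 0
    have "{z \<in> P. z \<preceq> \<Delta> [^] (0::nat)} \<subseteq> {\<one>}"
      using le_antisym[OF _ _ _ one_closed] by (auto simp: one_le_iff)
    then show ?case
      by (rule finite_subset) simp
  next
    case (Suc n)
    let ?D = "{z \<in> P. z \<preceq> \<Delta>}" and ?I = "{z \<in> P. z \<preceq> \<Delta> [^] n}"
    have "{z \<in> P. z \<preceq> \<Delta> [^] Suc n} \<subseteq> (\<lambda>(m, q). m \<otimes> q) ` (?D \<times> ?I)"
      using step by fast
    moreover have "finite ?D"
      using finite_simples by (simp add: le_def)
    ultimately show ?case
      using Suc finite_subset by blast
  qed
  show "\<exists>w \<in> lists letters. word_prod G w = p" if "p \<in> P" "p \<preceq> \<Delta> [^] (n::nat)"
    using that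
  proof (induction n arbitrary: p)
    case 0
    then have "p = \<one>"
      using le_antisym[of p \<one>] by (simp add: one_le_iff)
    then show ?case
      by (intro bexI[of _ "[]"]) simp_all
  next
    case (Suc n)
    then obtain m q where mq: "m \<in> P" "q \<in> P" "m \<preceq> \<Delta>" "q \<preceq> \<Delta> [^] n" "p = m \<otimes> q"
      using step by blast
    then obtain w where w: "w \<in> lists letters" "word_prod G w = q"
      using Suc.IH by blast
    have "m \<in> letters"
      using mq by (intro lettersI[of m 0]) (simp_all add: one_le_iff)
    then show ?case
      using w mq by (intro bexI[of _ "m # w"]) simp_all
  qed
qed

text \<open>Cofinality for the inverse, conjugated by the power of \<open>\<Delta>\<close>, becomes
  an upper bound.\<close>

lemma ex_le_pow:
  assumes "p \<in> carrier G"
  shows "\<exists>n::nat. p \<preceq> \<Delta> [^] n"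
proof -
  obtain n :: nat where "\<Delta> [^] n \<otimes> inv p \<in> P"
    using Delta_cofinal[of "inv p"] assms by auto
  from conj_inv_pow_P[OF this, of n] show ?thesis
    using assms by (auto simp: le_def m_assoc)
qed

lemma inv_Delta_letter [simp]: "inv \<Delta> \<in> letters"
  by (intro lettersI[of _ 1]) (simp_all add: one_le_iff)

lemma letters_generate:
  assumes "g \<in> carrier G"
  shows "\<exists>w \<in> lists letters. word_prod G w = g"
proof -
  obtain n :: nat where n: "\<Delta> [^] n \<otimes> g \<in> P"
    using Delta_cofinal assms by blast
  obtain w where w: "w \<in> lists letters" "word_prod G w = \<Delta> [^] n \<otimes> g"
    using P_generated[OF n] ex_le_pow assms by (metis Delta_carrier m_closed nat_pow_closed)
  have r: "word_prod G (replicate m (inv \<Delta>)) = inv (\<Delta> [^] m)" for m :: nat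
    by (induction m) (simp_all add: inv_mult_group)
  have "set w \<subseteq> carrier G"
    using w by auto
  then have "word_prod G (replicate n (inv \<Delta>) @ w) = g"
    using w assms by (subst word_prod_append) (auto simp: r)
  moreover have "replicate n (inv \<Delta>) @ w \<in> lists letters"
    using w by auto
  ultimately show ?thesis
    by blast
qed

lemma word_prod_filter:
  "set w \<subseteq> carrier G \<Longrightarrow> word_prod G (filter (\<lambda>x. x \<noteq> \<one>) w) = word_prod G w"
  by (induction w) auto

lemma alphabet_generates:
  assumes "g \<in> carrier G"
  shows "\<exists>w \<in> lists alphabet. word_prod G w = g"
proof -
  obtain w where w: "w \<in> lists letters" "word_prod G w = g"
    using letters_generate assms by blast
  have "set w \<subseteq> carrier G"
    using w by auto
  moreover have "filter (\<lambda>x. x \<noteq> \<one>) w \<in> lists alphabet"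
    using w by (auto simp: alphabet_def)
  ultimately show ?thesis
    using w word_prod_filter by metis
qed

text \<open>A letter is recovered from its shift, which lies in a finite interval, and an exponent
  that is 0 or 1.\<close>

lemma finite_alphabet: "finite alphabet"
proof -
  let ?I = "{z \<in> P. z \<preceq> \<Delta> [^] (1::nat)}"
  have "x \<in> (\<lambda>(z, e). z \<otimes> inv (\<Delta> [^] e)) ` (?I \<times> {0, 1::nat})" if "x \<in> letters" for x
  proof (rule image_eqI)
    show "x = (\<lambda>(z, e). z \<otimes> inv (\<Delta> [^] e)) (x \<otimes> \<Delta> [^] neg x, neg x)"
      using that by (simp add: m_assoc)
    show "(x \<otimes> \<Delta> [^] neg x, neg x) \<in> ?I \<times> {0, 1}"
      using letter_bounds[OF that] that by (simp add: one_le_iff neg_def)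
  qed
  then have "alphabet \<subseteq> (\<lambda>(z, e). z \<otimes> inv (\<Delta> [^] e)) ` (?I \<times> {0, 1::nat})"
    using alphabet_letters by blast
  then show ?thesis
    by (rule finite_subset) (intro finite_imageI finite_cartesian_product finite_interval, simp)
qed

section \<open>Fellow travelling\<close>

definition near :: "'g set" where
  "near = {z \<in> carrier G. \<one> \<preceq> z \<otimes> \<Delta> [^] (2::nat) \<and> z \<preceq> \<Delta> [^] (2::nat)}"

text \<open>Right translation by \<open>\<Delta> [^] 2\<close> is injective and moves
  \<open>near\<close> into the finite interval from \<open>\<one>\<close> to
  \<open>\<Delta> [^] 4\<close>.\<close>

lemma finite_near: "finite near"
proof (rule inj_on_finite)
  show "inj_on (\<lambda>z. z \<otimes> \<Delta> [^] (2::nat)) near"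
    by (intro inj_onI) (simp add: near_def)
  show "(\<lambda>z. z \<otimes> \<Delta> [^] (2::nat)) ` near \<subseteq> {z \<in> P. z \<preceq> \<Delta> [^] (4::nat)}"
    using le_mult_pow_iff[of _ "\<Delta> [^] (2::nat)" 2]
    by (auto simp: near_def one_le_iff nat_pow_mult)
qed (rule finite_interval)

lemma near_iff:
  assumes "x \<in> carrier G" "y \<in> carrier G"
  shows "inv x \<otimes> y \<in> near \<longleftrightarrow> x \<preceq> y \<otimes> \<Delta> [^] (2::nat) \<and> y \<preceq> x \<otimes> \<Delta> [^] (2::nat)"
  using assms le_mult_left_iff[of \<one> "inv x \<otimes> y \<otimes> \<Delta> [^] (2::nat)" x]
    le_mult_left_iff[of "inv x \<otimes> y" "\<Delta> [^] (2::nat)" x]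
  by (simp add: near_def m_assoc)

text \<open>For \<open>g \<preceq> h \<preceq> g \<otimes> \<Delta>\<close> the minimal exponents
  differ by at most one, so the two prefix formulas can be compared argument by argument.\<close>

lemma shortlex_normal_fellow_travel:
  assumes u: "shortlex_normal u" and v: "shortlex_normal v"
    and uv: "word_prod G u \<preceq> word_prod G v" "word_prod G v \<preceq> word_prod G u \<otimes> \<Delta>"
  shows "word_prod G (take i u) \<preceq> word_prod G (take i v) \<otimes> \<Delta> [^] (2::nat) \<and>
    word_prod G (take i v) \<preceq> word_prod G (take i u) \<otimes> \<Delta> [^] (2::nat)"
proof -
  have n: "normal_word u" "normal_word v"
    using u v by (simp_all add: shortlex_normal_def)
  define g h where "g = word_prod G u" and "h = word_prod G v"
  have c: "g \<in> carrier G" "h \<in> carrier G" and gh: "g \<preceq> h" "h \<preceq> g \<otimes> \<Delta>"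
    using n uv by (simp_all add: g_def h_def)
  let ?a = "nneg u" and ?b = "npos u" and ?a' = "nneg v" and ?b' = "npos v"
  note gb = shortlex_normal_le_pow_iff[OF u, folded g_def]
  note ga = shortlex_normal_one_le_iff[OF u, folded g_def]
  note hb = shortlex_normal_le_pow_iff[OF v, folded h_def]
  note ha = shortlex_normal_one_le_iff[OF v, folded h_def]
  have b1: "?b \<le> ?b'"
    using le_trans[OF gh(1), of "\<Delta> [^] ?b'"] c hb[of ?b'] gb[of ?b'] by simp
  have "g \<otimes> \<Delta> \<preceq> \<Delta> [^] Suc ?b"
    using gb[of ?b] le_mult_Delta_iff[of g "\<Delta> [^] ?b"] c by simp
  then have b2: "?b' \<le> Suc ?b"
    using le_trans[OF gh(2), of "\<Delta> [^] Suc ?b"] c hb[of "Suc ?b"] by (simp del: nat_pow_Suc)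
  have ghp: "g \<otimes> \<Delta> [^] n \<preceq> h \<otimes> \<Delta> [^] n" "h \<otimes> \<Delta> [^] n \<preceq> g \<otimes> \<Delta> [^] Suc n" for n :: nat
  proof -
    have "g \<otimes> \<Delta> \<otimes> \<Delta> [^] n = g \<otimes> \<Delta> [^] Suc n"
      using c by (simp add: m_assoc pow_Delta_commute)
    then show "g \<otimes> \<Delta> [^] n \<preceq> h \<otimes> \<Delta> [^] n" "h \<otimes> \<Delta> [^] n \<preceq> g \<otimes> \<Delta> [^] Suc n"
      using gh c le_mult_pow_iff[of h "g \<otimes> \<Delta>" n] by simp_all
  qed
  have a1: "?a' \<le> ?a"
    using le_trans[OF _ ghp(1), of \<one> ?a] c ha[of ?a] ga[of ?a] by simp
  have a2: "?a \<le> Suc ?a'"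
    using le_trans[OF _ ghp(2), of \<one> ?a'] c ha[of ?a'] ga[of "Suc ?a'"] by (simp del: nat_pow_Suc)
  define j k j' k' where "j = ?a - (i - ?b)" and "k = min i ?b"
    and "j' = ?a' - (i - ?b')" and "k' = min i ?b'"
  \<comment> \<open>The exponents differ by at most one; comparing \<open>h\<close> with
    \<open>g\<close> costs a further factor \<open>\<Delta>\<close>, hence
    \<open>Suc j'\<close>.\<close>
  have jk: "j \<le> j' + 2" "Suc j' \<le> j + 2" "k \<le> k' + 2" "k' \<le> k + 2"
    using a1 a2 b1 b2 unfolding j_def j'_def k_def k'_def by auto
  have ui: "word_prod G (take i u) = g \<otimes> \<Delta> [^] j \<curlywedge> \<Delta> [^] k"
    and vi: "word_prod G (take i v) = h \<otimes> \<Delta> [^] j' \<curlywedge> \<Delta> [^] k'"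
    using n normal_word_take by (simp_all add: g_def h_def j_def j'_def k_def k'_def)
  have "g \<otimes> \<Delta> [^] j \<preceq> h \<otimes> \<Delta> [^] (j' + 2)"
    using le_trans[OF ghp(1)[of j] le_mult_pow_mono[OF c(2) jk(1)]] c by simp
  moreover have "h \<otimes> \<Delta> [^] j' \<preceq> g \<otimes> \<Delta> [^] (j + 2)"
    using le_trans[OF ghp(2)[of j'] le_mult_pow_mono[OF c(1) jk(2)]] c by (simp del: nat_pow_Suc)
  ultimately have "g \<otimes> \<Delta> [^] j \<curlywedge> \<Delta> [^] k \<preceq> h \<otimes> \<Delta> [^] (j' + 2) \<curlywedge> \<Delta> [^] (k' + 2)"
    "h \<otimes> \<Delta> [^] j' \<curlywedge> \<Delta> [^] k' \<preceq> g \<otimes> \<Delta> [^] (j + 2) \<curlywedge> \<Delta> [^] (k + 2)"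
    using pow_mono[OF jk(3)] pow_mono[OF jk(4)] c
      le_trans[OF gmeet_le1] le_trans[OF gmeet_le2]
    by (auto intro!: gmeet_greatest simp del: add_2_eq_Suc')
  then show ?thesis
    unfolding ui vi using c by (simp add: gmeet_mult_pow m_assoc nat_pow_mult del: add_2_eq_Suc')
qed

text \<open>For negative \<open>x\<close> the roles of \<open>u\<close> and \<open>v\<close> are
  exchanged, which is possible because the fellow traveller bound is symmetric.\<close>

lemma shortlex_normal_near:
  assumes u: "shortlex_normal u" and v: "shortlex_normal v" and x: "x \<in> letters"
    and ux: "word_prod G u \<otimes> x = word_prod G v"
  shows "inv (word_prod G (take i u)) \<otimes> word_prod G (take i v) \<in> near"
proof -
  have n: "normal_word u" "normal_word v"
    using u v by (simp_all add: shortlex_normal_def)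
  have c: "word_prod G (take i u) \<in> carrier G" "word_prod G (take i v) \<in> carrier G"
    using n normal_word_append by (metis append_take_drop_id normal_word_carrier)+
  note cu = normal_word_carrier[OF n(1)]
  note b = letter_bounds[OF x]
  show ?thesis
  proof (cases "x \<in> P")
    case True
    then have "word_prod G u \<preceq> word_prod G v" "word_prod G v \<preceq> word_prod G u \<otimes> \<Delta>"
      using b cu x by (simp_all flip: ux)
    then show ?thesis
      using shortlex_normal_fellow_travel[OF u v] c by (simp add: near_iff)
  next
    case False
    then have "x \<preceq> \<one>" "\<one> \<preceq> x \<otimes> \<Delta>"
      using b le_mult_Delta_iff[of x \<one>] x by simp_all
    then have "word_prod G v \<preceq> word_prod G u" "word_prod G u \<preceq> word_prod G v \<otimes> \<Delta>"
      using cu x le_mult_left_iff[of x \<one> "word_prod G u"]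
        le_mult_left_iff[of \<one> "x \<otimes> \<Delta>" "word_prod G u"]
      by (simp_all add: m_assoc flip: ux)
    then show ?thesis
      using shortlex_normal_fellow_travel[OF v u] c by (simp add: near_iff)
  qed
qed

end

section \<open>Shortlex least words\<close>

text \<open>The number \<open>f\<close> of predecessors under \<open>R\<close> is strictly monotone;
  an enumeration \<open>c\<close> with values below \<open>n\<close> breaks ties without disturbing
  it.\<close>

lemma finite_linear_extension:
  assumes "finite A"
    and trans: "\<And>x y z. \<lbrakk>x \<in> A; y \<in> A; z \<in> A; R x y; R y z\<rbrakk> \<Longrightarrow> R x z"
    and antisym: "\<And>x y. \<lbrakk>x \<in> A; y \<in> A; R x y; R y x\<rbrakk> \<Longrightarrow> x = y"
    and refl: "\<And>x. x \<in> A \<Longrightarrow> R x x"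
  shows "\<exists>k :: 'x \<Rightarrow> nat. inj_on k A \<and> (\<forall>x \<in> A. \<forall>y \<in> A. R x y \<longrightarrow> x \<noteq> y \<longrightarrow> k x < k y)"
proof -
  obtain c :: "'x \<Rightarrow> nat" and n where c: "inj_on c A" "c ` A = {i. i < n}"
    using finite_imp_inj_to_nat_seg[OF assms(1)] by metis
  define f where "f y = card {x \<in> A. R x y}" for y
  define k where "k x = f x * n + c x" for x
  have cn: "c x < n" if "x \<in> A" for x
    using c that by blast
  have k_less: "k x < k y" if "f x < f y" "x \<in> A" for x y
  proof -
    have "k x < Suc (f x) * n"
      using cn[OF that(2)] by (simp add: k_def)
    also have "\<dots> \<le> f y * n"
      using that(1) by (intro mult_le_mono1) simp
    finally show ?thesis
      by (simp add: k_def)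
  qed
  have "f x < f y" if "x \<in> A" "y \<in> A" "R x y" "x \<noteq> y" for x y
    unfolding f_def
  proof (rule psubset_card_mono)
    show "{z \<in> A. R z x} \<subset> {z \<in> A. R z y}"
      using that trans antisym refl by blast
  qed (use assms(1) in simp)
  moreover have "inj_on k A"
  proof (rule inj_onI)
    fix x y assume xy: "x \<in> A" "y \<in> A" "k x = k y"
    then have "f x = f y"
      using k_less by (metis less_irrefl linorder_neqE_nat)
    then have "c x = c y"
      using xy by (simp add: k_def)
    then show "x = y"
      using c xy by (simp add: inj_on_eq_iff)
  qed
  ultimately show ?thesis
    using k_less by blast
qed

text \<open>Keys run against the order: a larger letter has a smaller key, so enlarging a letter
  produces an earlier word.\<close>

locale garside_group_order = garside_group +
  fixes k :: "'a \<Rightarrow> nat"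
  assumes k_inj: "inj_on k alphabet"
    and k_less: "\<lbrakk>x \<in> alphabet; y \<in> alphabet; y \<preceq> x; x \<noteq> y\<rbrakk> \<Longrightarrow> k x < k y"
begin

definition order_rel :: "('a \<times> 'a) set" where
  "order_rel = {(x, y) \<in> alphabet \<times> alphabet. k x \<le> k y}"

lemma linear_order_rel: "linear_order_on alphabet order_rel"
  using k_inj unfolding order_rel_def linear_order_on_def partial_order_on_def preorder_on_def
  by (auto simp: refl_on_def trans_def antisym_def total_on_def inj_on_def)

lemma strict_order_rel: "order_rel - Id = {(x, y) \<in> alphabet \<times> alphabet. k x < k y}"
  using k_inj by (auto simp: order_rel_def inj_on_def order_less_le)

lemma wf_shortlex: "wf (shortlex_less order_rel)"
  unfolding shortlex_less_def
proof (rule wf_lenlex)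
  show "wf (order_rel - Id)"
    by (rule wf_subset[OF wf_measure[of k]]) (auto simp: strict_order_rel)
qed

lemma shortlex_total:
  assumes "u \<in> lists alphabet" "v \<in> lists alphabet" "u \<noteq> v"
  shows "(u, v) \<in> shortlex_less order_rel \<or> (v, u) \<in> shortlex_less order_rel"
  using assms
proof (induction u arbitrary: v rule: list.induct)
  case Nil
  then show ?case by (simp add: shortlex_less_def)
next
  case (Cons x u)
  show ?case
  proof (cases v)
    case Nil
    then show ?thesis by (simp add: shortlex_less_def)
  next
    case v: (Cons y v')
    have "x \<in> alphabet" "y \<in> alphabet"
      using Cons.prems v by simp_all
    then have "(x, y) \<in> order_rel - Id \<or> (y, x) \<in> order_rel - Id \<or> x = y"
      using inj_onD[OF k_inj, of x y]
      by (cases "k x" "k y" rule: linorder_cases) (auto simp: strict_order_rel)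
    then show ?thesis
      using Cons.IH[of v'] Cons.prems v unfolding shortlex_less_def Cons_lenlex_iff
      by (auto simp: Cons_lenlex_iff not_less_iff_gr_or_eq)
  qed
qed

section \<open>Shortlex least words and their rewriting\<close>

abbreviation shortlex_words :: "'a list set" where
  "shortlex_words \<equiv> SL G alphabet order_rel"

lemma ex_shortlex_word:
  assumes "g \<in> carrier G"
  shows "\<exists>w \<in> shortlex_words. word_prod G w = g"
proof -
  define W where "W = {w \<in> lists alphabet. word_prod G w = g}"
  have "W \<noteq> {}"
    using alphabet_generates[OF assms] by (auto simp: W_def)
  then obtain w where w: "w \<in> W" "\<And>v. (v, w) \<in> shortlex_less order_rel \<Longrightarrow> v \<notin> W"
    using wf_shortlex by (metis wfE_min ex_in_conv)
  then have "shortlex_least_word G alphabet order_rel g w"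
    using shortlex_total unfolding shortlex_least_word_def W_def by blast
  then show ?thesis
    using assms w by (auto simp: SL_def W_def)
qed

lemma shortlex_words_lists: "w \<in> shortlex_words \<Longrightarrow> w \<in> lists alphabet"
  by (auto simp: SL_def shortlex_least_word_def)

text \<open>Competitors may contain the identity as a letter: deleting it keeps the element and only
  shortens the word, and at equal length nothing was deleted.\<close>

lemma shortlex_word_min:
  assumes w: "w \<in> shortlex_words" and v: "v \<in> lists letters" "word_prod G v = word_prod G w"
  shows "length w \<le> length v"
    and "\<lbrakk>length v = length w; v \<noteq> w\<rbrakk> \<Longrightarrow> (w, v) \<in> shortlex_less order_rel"
proof -
  define v' where "v' = filter (\<lambda>x. x \<noteq> \<one>) v"
  have "v' \<in> lists alphabet"
    using v by (auto simp: v'_def alphabet_def)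
  moreover have "set v \<subseteq> carrier G"
    using v by auto
  then have "word_prod G v' = word_prod G w"
    using word_prod_filter v by (simp add: v'_def)
  ultimately have *: "v' = w \<or> (w, v') \<in> shortlex_less order_rel"
    using w by (auto simp: SL_def shortlex_least_word_def)
  then have "length w \<le> length v'"
    using lenlex_length by (auto simp: shortlex_less_def)
  moreover have "length v' \<le> length v"
    by (simp add: v'_def)
  moreover have "v' = v" if "length v' = length v"
    using that length_filter_less[of _ v "\<lambda>x. x \<noteq> \<one>"] unfolding v'_def
    by (metis (mono_tags, lifting) filter_True less_irrefl)
  ultimately show "length w \<le> length v"
    and "\<lbrakk>length v = length w; v \<noteq> w\<rbrakk> \<Longrightarrow> (w, v) \<in> shortlex_less order_rel"
    using * by auto
qed

text \<open>Otherwise replacing the pair would give a word with the same element and length that is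
  earlier at the first changed letter, by \<open>k_less\<close>.\<close>

lemma shortlex_word_pair:
  assumes w: "u @ [x, y] @ v \<in> shortlex_words"
    and xy': "x' \<in> letters" "y' \<in> letters" "x' \<otimes> y' = x \<otimes> y" "x \<preceq> x'"
  shows "x' = x"
proof (rule ccontr)
  assume "x' \<noteq> x"
  let ?w = "u @ [x, y] @ v" and ?w' = "u @ [x', y'] @ v"
  have l: "set u \<subseteq> letters" "set v \<subseteq> letters" "x \<in> alphabet" "y \<in> letters"
    using shortlex_words_lists[OF w] by auto
  then have c: "set u \<subseteq> carrier G" "set v \<subseteq> carrier G"
    using letters_carrier by blast+
  have "x' \<otimes> (y' \<otimes> word_prod G v) = x \<otimes> (y \<otimes> word_prod G v)"
    using xy' l c by (metis alphabet_letters letters_carrier m_assoc word_prod_closed)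
  then have "word_prod G ?w' = word_prod G ?w"
    using c l xy' by (simp add: word_prod_append)
  then have "(?w, ?w') \<in> shortlex_less order_rel"
    using shortlex_word_min(2)[OF w, of ?w'] l xy' \<open>x' \<noteq> x\<close> by (auto simp: subset_iff)
  then have "(x, x') \<in> order_rel - Id"
    using \<open>x' \<noteq> x\<close> by (simp add: shortlex_less_def irrefl_def Cons_lenlex_iff)
  then show False
    using k_less[of x' x] xy'(4) \<open>x' \<noteq> x\<close> by (auto simp: strict_order_rel)
qed

text \<open>The two left-greedy rewritings of a product of two letters: the signs are kept for
  \<open>e\<^sub>1 = neg x\<close>, and a negative letter followed by a positive one is swapped for \<open>e\<^sub>1 = 0\<close>.\<close>

lemma greedy_pair:
  assumes x: "x \<in> letters" and y: "y \<in> letters"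
    and e: "e\<^sub>1 + e\<^sub>2 = neg y + neg x" "e\<^sub>1 \<le> neg x" "e\<^sub>2 \<le> 1"
  obtains x' y' where "x' \<in> letters" "y' \<in> letters" "x' \<otimes> y' = x \<otimes> y" "x \<preceq> x'"
    "x' \<otimes> \<Delta> [^] e\<^sub>1 = \<Delta> \<curlywedge> x \<otimes> y \<otimes> \<Delta> [^] (neg y + neg x)"
proof -
  define q where "q = x \<otimes> y \<otimes> \<Delta> [^] (neg y + neg x)"
  define x' where "x' = (\<Delta> \<curlywedge> q) \<otimes> inv (\<Delta> [^] e\<^sub>1)"
  define y' where "y' = inv x' \<otimes> (x \<otimes> y)"
  have q: "q \<in> carrier G" using x y by (simp add: q_def)
  then have x'c: "x' \<in> carrier G" by (simp add: x'_def)
  then have y'c: "y' \<in> carrier G" using x y by (simp add: y'_def)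
  have x'y': "x' \<otimes> y' = x \<otimes> y"
    using x'c x y by (simp add: y'_def)
  have x'e: "x' \<otimes> \<Delta> [^] e\<^sub>1 = \<Delta> \<curlywedge> q"
    using q by (simp add: x'_def m_assoc)
  have qx: "x \<otimes> (y \<otimes> \<Delta> [^] neg y) \<otimes> \<Delta> [^] neg x = q"
    using x y by (simp add: q_def m_assoc nat_pow_mult)
  have "x \<preceq> x \<otimes> (y \<otimes> \<Delta> [^] neg y)"
    using letter_bounds(1)[OF y] x y by (simp add: one_le_iff)
  then have xq: "x \<otimes> \<Delta> [^] neg x \<preceq> q"
    unfolding qx[symmetric] using x y by simp
  then have xm: "x \<otimes> \<Delta> [^] neg x \<preceq> \<Delta> \<curlywedge> q"
    using letter_bounds(2)[OF x] x q by (simp add: le_gmeet_iff)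
  have "x \<otimes> (y \<otimes> \<Delta> [^] neg y) \<otimes> \<Delta> [^] neg x \<preceq> x \<otimes> \<Delta> \<otimes> \<Delta> [^] neg x"
    using letter_bounds(2)[OF y] x y by simp
  moreover have "x \<otimes> \<Delta> \<otimes> \<Delta> [^] neg x = x \<otimes> \<Delta> [^] neg x \<otimes> \<Delta>"
    using x by (simp add: m_assoc pow_Delta_commute)
  moreover have "x \<otimes> \<Delta> [^] neg x \<otimes> \<Delta> \<preceq> \<Delta> \<otimes> \<Delta>"
    using letter_bounds(2)[OF x] x by simp
  ultimately have q2: "q \<preceq> \<Delta> \<otimes> \<Delta>"
    using q x le_trans[of q "x \<otimes> \<Delta> [^] neg x \<otimes> \<Delta>" "\<Delta> \<otimes> \<Delta>"] by (simp add: qx)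
  show thesis
  proof (rule that[of x' y'])
    have "\<one> \<preceq> \<Delta> \<curlywedge> q"
      using le_trans[OF letter_bounds(1)[OF x] xm] x q by simp
    then show "x' \<in> letters"
      using e q x'c by (intro lettersI[of x' e\<^sub>1]) (auto simp: x'e gmeet_le1 neg_def split: if_splits)
    have "x' \<otimes> y' \<otimes> \<Delta> [^] e\<^sub>2 \<otimes> \<Delta> [^] e\<^sub>1 = q"
      using x y e unfolding x'y' q_def by (simp add: m_assoc nat_pow_mult add.commute)
    then have y'e: "x' \<otimes> (y' \<otimes> \<Delta> [^] e\<^sub>2) \<otimes> \<Delta> [^] e\<^sub>1 = q"
      using x'c y'c by (simp add: m_assoc)
    have "x' \<otimes> \<one> \<otimes> \<Delta> [^] e\<^sub>1 \<preceq> q"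
      using x'c q by (simp add: x'e gmeet_le2)
    then have y1: "\<one> \<preceq> y' \<otimes> \<Delta> [^] e\<^sub>2"
      unfolding y'e[symmetric] using x'c y'c
      by (simp only: le_mult_left_iff le_mult_pow_iff m_closed nat_pow_closed one_closed Delta_carrier)
    \<comment> \<open>The right side is the meet of \<open>\<Delta> \<otimes> \<Delta>\<close> and
      \<open>q \<otimes> \<Delta>\<close>, both above \<open>q\<close>. Cancelling \<open>x'\<close>
      and the power of \<open>\<Delta>\<close> bounds the second letter.\<close>
    have "q \<preceq> (\<Delta> \<curlywedge> q) \<otimes> \<Delta>"
      using q q2 gmeet_mult_pow[of \<Delta> q 1] by (simp add: le_gmeet_iff)
    also have "(\<Delta> \<curlywedge> q) \<otimes> \<Delta> = x' \<otimes> \<Delta> \<otimes> \<Delta> [^] e\<^sub>1"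
      using x'c by (simp add: pow_Delta_commute m_assoc flip: x'e)
    finally have y2: "y' \<otimes> \<Delta> [^] e\<^sub>2 \<preceq> \<Delta>"
      unfolding y'e[symmetric] using x'c y'c by simp
    show "y' \<in> letters"
      using y'c e y1 y2 by (intro lettersI[of y' e\<^sub>2]) auto
    have "x \<otimes> \<Delta> [^] neg x \<preceq> x' \<otimes> \<Delta> [^] neg x"
      using le_trans[OF xm[folded x'e] le_mult_pow_mono[OF x'c e(2)]] x x'c by simp
    then show "x \<preceq> x'"
      using x x'c by simp
    show "x' \<otimes> y' = x \<otimes> y" by (rule x'y')
    show "x' \<otimes> \<Delta> [^] e\<^sub>1 = \<Delta> \<curlywedge> x \<otimes> y \<otimes> \<Delta> [^] (neg y + neg x)"
      using x'e by (simp add: q_def)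
  qed
qed

text \<open>The greedy rewriting that keeps the signs cannot change \<open>x\<close>, which is the
  meet equation. The one that swaps the signs would turn a negative \<open>x\<close> into a positive
  letter, so a positive letter never follows a negative one.\<close>

lemma shortlex_word_normal_pair:
  assumes w: "u @ [x, y] @ v \<in> shortlex_words"
  shows "normal_pair x y"
proof -
  have x: "x \<in> letters" and y: "y \<in> letters"
    using shortlex_words_lists[OF w] by auto
  have "x \<otimes> \<Delta> [^] neg x = \<Delta> \<curlywedge> x \<otimes> y \<otimes> \<Delta> [^] (neg y + neg x)"
  proof -
    obtain x' y' where "x' \<in> letters" "y' \<in> letters" "x' \<otimes> y' = x \<otimes> y" "x \<preceq> x'"
      and eq: "x' \<otimes> \<Delta> [^] neg x = \<Delta> \<curlywedge> x \<otimes> y \<otimes> \<Delta> [^] (neg y + neg x)"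
      by (rule greedy_pair[OF x y, of "neg x" "neg y"]) (auto simp: neg_def)
    then have "x' = x"
      using shortlex_word_pair[OF w] by blast
    then show ?thesis
      using eq by simp
  qed
  moreover have "x \<in> P" if yP: "y \<in> P"
  proof (rule ccontr)
    assume "x \<notin> P"
    obtain x' y' where x': "x' \<in> letters" "y' \<in> letters" "x' \<otimes> y' = x \<otimes> y" "x \<preceq> x'"
      and eq: "x' \<otimes> \<Delta> [^] (0::nat) = \<Delta> \<curlywedge> x \<otimes> y \<otimes> \<Delta> [^] (neg y + neg x)"
      by (rule greedy_pair[OF x y, of 0 1]) (use yP \<open>x \<notin> P\<close> in auto)
    \<comment> \<open>Both factors are positive, hence so is \<open>x'\<close>, the meet of this
      element with \<open>\<Delta>\<close>.\<close>
    have "x \<otimes> y \<otimes> \<Delta> = (x \<otimes> \<Delta>) \<otimes> (inv \<Delta> \<otimes> y \<otimes> \<Delta>)"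
      using x y by (simp add: m_assoc)
    also have "\<dots> \<in> P"
      using letter_bounds(1)[OF x] \<open>x \<notin> P\<close> x that
      by (intro mult_P[OF _ conj_inv_P]) (simp_all add: one_le_iff)
    finally have "\<one> \<preceq> x'"
      using eq x' x y that \<open>x \<notin> P\<close> by (simp add: le_gmeet_iff one_le_iff)
    moreover have "x' = x"
      using shortlex_word_pair[OF w] x' by blast
    ultimately show False
      using \<open>x \<notin> P\<close> x by (simp add: one_le_iff)
  qed
  ultimately show ?thesis
    by (simp add: normal_pair_def)
qed

lemma conj_letter:
  assumes "x \<in> letters"
  shows "\<Delta> \<otimes> x \<otimes> inv \<Delta> \<in> letters"
proof (rule lettersI[of _ "neg x"])
  note b = letter_bounds[OF assms]
  have "\<Delta> \<otimes> x \<otimes> inv \<Delta> \<otimes> \<Delta> [^] neg x = \<Delta> \<otimes> (x \<otimes> \<Delta> [^] neg x) \<otimes> inv \<Delta>"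
    using assms by (cases "x \<in> P") (simp_all add: m_assoc)
  moreover have "\<one> \<preceq> \<Delta> \<otimes> (x \<otimes> \<Delta> [^] neg x) \<otimes> inv \<Delta>"
    using conj_P[of "x \<otimes> \<Delta> [^] neg x"] b(1) assms by (simp add: one_le_iff)
  moreover have "\<Delta> \<otimes> (x \<otimes> \<Delta> [^] neg x) \<otimes> inv \<Delta> \<preceq> \<Delta>"
    using conj_P[of "inv (x \<otimes> \<Delta> [^] neg x) \<otimes> \<Delta>"] b(2) assms
    by (simp add: le_def inv_mult_group m_assoc)
  ultimately show "\<one> \<preceq> \<Delta> \<otimes> x \<otimes> inv \<Delta> \<otimes> \<Delta> [^] neg x"
    and "\<Delta> \<otimes> x \<otimes> inv \<Delta> \<otimes> \<Delta> [^] neg x \<preceq> \<Delta>"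
    by simp_all
qed (use assms in \<open>auto simp: neg_def\<close>)

lemma word_prod_conj:
  assumes "set w \<subseteq> carrier G"
  shows "word_prod G (map (\<lambda>x. \<Delta> \<otimes> x \<otimes> inv \<Delta>) w) = \<Delta> \<otimes> word_prod G w \<otimes> inv \<Delta>"
  using assms by (induction w) (simp_all add: m_assoc)

text \<open>Conjugation by \<open>\<Delta>\<close> preserves the letters, so a letter \<open>\<Delta>\<close> (or \<open>inv \<Delta>\<close>) can be moved
  through a word and absorbed by a letter of opposite sign.\<close>

lemma shortlex_word_normal:
  assumes w: "w \<in> shortlex_words"
  shows "shortlex_normal w"
  unfolding shortlex_normal_def
proof (intro conjI)
  have l: "set w \<subseteq> letters"
    using shortlex_words_lists[OF w] by auto
  show "normal_word w"
    unfolding normal_word_def successively_conv_nth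
  proof (intro conjI allI impI)
    fix i assume i: "Suc i < length w"
    then have "w = take i w @ [w ! i, w ! Suc i] @ drop (Suc (Suc i)) w"
      by (simp add: Cons_nth_drop_Suc id_take_nth_drop)
    then show "normal_pair (w ! i) (w ! Suc i)"
      using shortlex_word_normal_pair w by metis
  qed (rule shortlex_words_lists[OF w])
  \<comment> \<open>Merging the two end letters into one letter \<open>z\<close>, placed at either
    end, would give a shorter word for the same element.\<close>
  have no: False if "w = x # u @ [y]" "z \<in> letters" "v \<in> lists letters"
    "length v = length u" "z \<otimes> word_prod G v = x \<otimes> word_prod G u \<otimes> y \<or>
      word_prod G v \<otimes> z = x \<otimes> word_prod G u \<otimes> y" for x y z u v
  proof -
    have c: "set u \<subseteq> carrier G" "x \<in> carrier G" "y \<in> carrier G" "set v \<subseteq> carrier G"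
      using l that(1,3) by auto
    then have wp: "word_prod G w = x \<otimes> word_prod G u \<otimes> y"
      using that(1) by (simp add: word_prod_append m_assoc)
    have "\<exists>v' \<in> {z # v, v @ [z]}. word_prod G v' = word_prod G w"
      using that(2,5) c wp by (auto simp: word_prod_append)
    then obtain v' where "v' = z # v \<or> v' = v @ [z]" "word_prod G v' = word_prod G w"
      by blast
    moreover from this have "v' \<in> lists letters" "length v' = Suc (length u)"
      using that(2,3,4) by auto
    ultimately show False
      using shortlex_word_min(1)[OF w, of v'] that(1) by simp
  qed
  have split: "\<exists>u. w = hd w # u @ [last w]" if "w \<noteq> []" "hd w \<noteq> last w"
    using that by (cases w; cases "tl w" rule: rev_cases) auto
  let ?c = "map (\<lambda>x. \<Delta> \<otimes> x \<otimes> inv \<Delta>)"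
  have cl: "?c u \<in> lists letters" if "set u \<subseteq> letters" for u
    using conj_letter[OF subsetD[OF that]] by auto
  have 1: "\<not> (hd w = \<Delta> \<and> last w \<notin> P)" if ne: "w \<noteq> []"
  proof
    assume h: "hd w = \<Delta> \<and> last w \<notin> P"
    then obtain u where u: "w = \<Delta> # u @ [last w]"
      using split[OF ne] by (metis Delta_P)
    have t: "last w \<in> letters" and ul: "set u \<subseteq> letters"
      using l that u by (auto, metis Un_iff in_mono set_append set_subset_Cons subsetD)
    have b: "\<one> \<preceq> last w \<otimes> \<Delta>" "last w \<preceq> \<one>"
      using letter_bounds[OF t] h t le_mult_Delta_iff[of "last w" \<one>] by simp_all
    \<comment> \<open>The leading \<open>\<Delta>\<close> is pushed to the end, conjugating the
      middle of the word, and merges with the last letter.\<close>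
    have z: "\<Delta> \<otimes> last w \<in> letters"
    proof (rule lettersI[of _ 0])
      show "\<one> \<preceq> \<Delta> \<otimes> last w \<otimes> \<Delta> [^] (0::nat)"
        using conj_P[of "last w \<otimes> \<Delta>"] b t by (simp add: one_le_iff m_assoc)
      show "\<Delta> \<otimes> last w \<otimes> \<Delta> [^] (0::nat) \<preceq> \<Delta>"
        using b t le_mult_left_iff[of "last w" \<one> \<Delta>] by simp
    qed (use t in auto)
    have "word_prod G (?c u) \<otimes> (\<Delta> \<otimes> last w) = \<Delta> \<otimes> word_prod G u \<otimes> last w"
    proof -
      have "set u \<subseteq> carrier G" using ul letters_carrier by blast
      then show ?thesis using t by (simp add: word_prod_conj m_assoc)
    qed
    then show False
      using no[OF u z cl[OF ul]] by simp
  qed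
  have 2: "\<not> (hd w \<in> P \<and> last w = inv \<Delta>)" if ne: "w \<noteq> []"
  proof
    assume h: "hd w \<in> P \<and> last w = inv \<Delta>"
    \<comment> \<open>Equality would make \<open>inv \<Delta>\<close> positive, hence trivial. So
      the word has at least two letters.\<close>
    have "hd w \<noteq> last w"
    proof
      assume "hd w = last w"
      then have "inv \<Delta> = \<one>"
        using h P_units[of \<Delta>] by simp
      moreover have "last w \<noteq> \<one>"
        using shortlex_words_lists[OF w] that by (metis Diff_iff alphabet_def in_listsD insertI1 last_in_set)
      ultimately show False
        using h by simp
    qed
    then obtain u where u: "w = hd w # u @ [inv \<Delta>]"
      using split[OF ne] h by auto
    have s: "hd w \<in> letters" and ul: "set u \<subseteq> letters"
      using l that u by (auto, metis Un_iff in_mono set_append set_subset_Cons subsetD)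
    \<comment> \<open>The final \<open>inv \<Delta>\<close> is pulled to the front; this again
      conjugates the middle by \<open>\<Delta>\<close>.\<close>
    have z: "hd w \<otimes> inv \<Delta> \<in> letters"
      using s letter_bounds[OF s] h by (intro lettersI[of _ 1]) (simp_all add: m_assoc)
    have "(hd w \<otimes> inv \<Delta>) \<otimes> word_prod G (?c u) = hd w \<otimes> word_prod G u \<otimes> inv \<Delta>"
    proof -
      have "set u \<subseteq> carrier G" using ul letters_carrier by blast
      then show ?thesis using s by (simp add: word_prod_conj m_assoc)
    qed
    then show False
      using no[OF u z cl[OF ul]] by simp
  qed
  show "w = [] \<or> \<not> (hd w = \<Delta> \<and> last w \<notin> P) \<and> \<not> (hd w \<in> P \<and> last w = inv \<Delta>)"
    using 1 2 by blast
qed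

text \<open>For the converse of \<open>shortlex_word_normal\<close>, the shortlex least word of the
  same element is itself normal, hence equal to the given word by uniqueness.\<close>

lemma shortlex_words_eq: "shortlex_words = {w. shortlex_normal w}"
proof (intro equalityI subsetI)
  fix w assume "w \<in> {w. shortlex_normal w}"
  then have w: "shortlex_normal w" by simp
  then have "word_prod G w \<in> carrier G"
    by (simp add: shortlex_normal_def)
  then obtain v where "v \<in> shortlex_words" "word_prod G v = word_prod G w"
    using ex_shortlex_word by blast
  then show "w \<in> shortlex_words"
    using shortlex_normal_unique shortlex_word_normal w by metis
qed (simp add: shortlex_word_normal)

end

section \<open>The automatic structure and its alphabet\<close>

lemma (in garside_group_order) shortlex_automatic_order_rel:
  "shortlex_automatic G alphabet order_rel"
  unfolding shortlex_automatic_def automatic_structure_def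
proof (intro conjI ballI)
  show "linear_order_on alphabet order_rel"
    by (rule linear_order_rel)
  show X: "alphabet \<subseteq> carrier G"
    by auto
  have "shortlex_words = {w \<in> lists alphabet. successively normal_pair w \<and>
      (w = [] \<or> \<not> (hd w = \<Delta> \<and> last w \<notin> P) \<and> \<not> (hd w \<in> P \<and> last w = inv \<Delta>))}"
    unfolding shortlex_words_eq shortlex_normal_def normal_word_def by blast
  then show reg: "regular_language alphabet shortlex_words"
    using regular_language_successively[OF finite_alphabet, of normal_pair
      "\<lambda>x y. \<not> (x = \<Delta> \<and> y \<notin> P) \<and> \<not> (x \<in> P \<and> y = inv \<Delta>)"] by simp
  show "word_prod G ` shortlex_words = carrier G"
    using ex_shortlex_word shortlex_words_eq by (auto simp: shortlex_normal_def)
  fix x assume "x \<in> insert \<one> alphabet"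
  then have x: "x \<in> letters" by auto
  show "regular_language (padded_alphabet alphabet) {padded_pair u v | u v.
      u \<in> shortlex_words \<and> v \<in> shortlex_words \<and> word_prod G u \<otimes> x = word_prod G v}"
  proof (rule regular_language_multiplier[OF X reg finite_near])
    show "near \<subseteq> carrier G"
      by (auto simp: near_def)
    show "inv (word_prod G (take i u)) \<otimes> word_prod G (take i v) \<in> near"
      if "u \<in> shortlex_words" "v \<in> shortlex_words" "word_prod G u \<otimes> x = word_prod G v" for u v i
      using shortlex_normal_near that x by (simp add: shortlex_words_eq)
  qed (use x in simp)
qed

lemma (in garside_group) ex_shortlex_automatic:
  "\<exists>r. linear_order_on alphabet r \<and> shortlex_automatic G alphabet r"
proof -
  have "\<exists>k :: 'g \<Rightarrow> nat. inj_on k alphabet \<and>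
      (\<forall>x \<in> alphabet. \<forall>y \<in> alphabet. y \<preceq> x \<longrightarrow> x \<noteq> y \<longrightarrow> k x < k y)"
    by (rule finite_linear_extension[OF finite_alphabet, where R = "\<lambda>x y. y \<preceq> x"])
      (auto intro: le_trans le_antisym)
  then obtain k :: "'g \<Rightarrow> nat" where "inj_on k alphabet"
    "\<forall>x \<in> alphabet. \<forall>y \<in> alphabet. y \<preceq> x \<longrightarrow> x \<noteq> y \<longrightarrow> k x < k y"
    by blast
  then interpret garside_group_order G P \<Delta> k
    by unfold_locales auto
  show ?thesis
    using linear_order_rel shortlex_automatic_order_rel by blast
qed

text \<open>Inversion turns \<open>x \<preceq> \<one>\<close> into positivity of
  \<open>inv x\<close>, and \<open>x \<otimes> \<Delta> \<in> P\<close> into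
  \<open>inv x \<preceq> \<Delta>\<close>; so negative letters are the inverses of positive
  ones.\<close>

lemma (in garside_group) alphabet_eq:
  "alphabet = {s \<in> P. s \<preceq> \<Delta>} - {\<one>} \<union> m_inv G ` ({s \<in> P. s \<preceq> \<Delta>} - {\<one>})"
proof (intro equalityI subsetI)
  fix x assume x: "x \<in> alphabet"
  then have c: "x \<in> carrier G" "x \<noteq> \<one>"
    by (auto simp: alphabet_def letters_carrier)
  show "x \<in> {s \<in> P. s \<preceq> \<Delta>} - {\<one>} \<union> m_inv G ` ({s \<in> P. s \<preceq> \<Delta>} - {\<one>})"
  proof (cases "x \<in> P")
    case True
    then show ?thesis
      using letter_bounds(2)[of x] x c by simp
  next
    case False
    then have "inv x \<in> {s \<in> P. s \<preceq> \<Delta>} - {\<one>}"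
      using letter_bounds[of x] x c le_mult_Delta_iff[of x \<one>]
      by (simp add: le_def one_le_iff inv_mult_group)
    then show ?thesis
      using c by (intro UnI2 image_eqI[of x _ "inv x"]) simp_all
  qed
next
  fix x assume "x \<in> {s \<in> P. s \<preceq> \<Delta>} - {\<one>} \<union> m_inv G ` ({s \<in> P. s \<preceq> \<Delta>} - {\<one>})"
  then show "x \<in> alphabet"
  proof
    assume "x \<in> {s \<in> P. s \<preceq> \<Delta>} - {\<one>}"
    moreover from this have "x \<in> letters"
      by (intro lettersI[of x 0]) (simp_all add: one_le_iff)
    ultimately show ?thesis
      by (simp add: alphabet_def)
  next
    assume "x \<in> m_inv G ` ({s \<in> P. s \<preceq> \<Delta>} - {\<one>})"
    then obtain s where s: "s \<in> P" "s \<preceq> \<Delta>" "s \<noteq> \<one>" "x = inv s"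
      by blast
    then have "inv s \<in> letters"
      by (intro lettersI[of _ 1]) (simp_all add: le_def inv_mult_group conj_inv_P)
    then show ?thesis
      using s by (simp add: alphabet_def)
  qed
qed

section \<open>Groups of fractions\<close>

context garside_monoid
begin

abbreviation simples :: "'a set" where
  "simples \<equiv> left_divisors M \<Delta>"

lemma simples_carrier: "s \<in> simples \<Longrightarrow> s \<in> carrier M"
  by (simp add: left_divisors_def)

text \<open>By \<open>Delta_divisors\<close> it does not matter on which side an element divides
  \<open>\<Delta>\<close>, so cofactors exist on both sides and are simple.\<close>

lemma simples_complement:
  assumes "s \<in> simples"
  shows "\<exists>t \<in> simples. \<Delta> = s \<otimes> t" "\<exists>t \<in> simples. \<Delta> = t \<otimes> s"
proof -
  obtain t where t: "t \<in> carrier M" "\<Delta> = s \<otimes> t"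
    using assms by (auto simp: left_divisors_def factor_def)
  then have "t \<in> right_divisors M \<Delta>"
    using simples_carrier[OF assms] by (auto simp: right_divisors_def opposite_def factor_def)
  then show "\<exists>t \<in> simples. \<Delta> = s \<otimes> t"
    using t Delta_divisors by blast
  have "s \<in> right_divisors M \<Delta>"
    using assms Delta_divisors by simp
  then obtain t where "t \<in> carrier M" "\<Delta> = t \<otimes> s"
    by (auto simp: right_divisors_def opposite_def factor_def)
  then show "\<exists>t \<in> simples. \<Delta> = t \<otimes> s"
    using simples_carrier[OF assms] by (auto simp: left_divisors_def factor_def)
qed

lemma simples_induct [consumes 1, case_names one mult]:
  assumes "a \<in> carrier M" "Q \<one>"
    and "\<And>s b. \<lbrakk>s \<in> simples; b \<in> carrier M; Q b\<rbrakk> \<Longrightarrow> Q (s \<otimes> b)"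
  shows "Q a"
proof -
  have "a \<in> word_prod M ` lists simples"
    using assms(1) Delta_divisors_generate by (simp add: monoid_generates_def)
  then obtain w where w: "w \<in> lists simples" "word_prod M w = a"
    by blast
  have "word_prod M w \<in> carrier M \<and> Q (word_prod M w)"
    using w(1) assms(2,3) by (induction w rule: list.induct) (auto simp: simples_carrier)
  then show ?thesis
    using w(2) by simp
qed

text \<open>For simple \<open>s\<close>, complementing twice as
  \<open>\<Delta> = t \<otimes> s = t' \<otimes> t\<close> gives
  \<open>\<Delta> \<otimes> s = t' \<otimes> \<Delta>\<close>; simple elements generate. The left
  version mirrors this.\<close>

lemma Delta_commute_right: "a \<in> carrier M \<Longrightarrow> \<exists>b \<in> carrier M. \<Delta> \<otimes> a = b \<otimes> \<Delta>"
proof (induction a rule: simples_induct)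
  case one
  then show ?case using Delta_closed by (intro bexI[of _ \<one>]) auto
next
  case (mult s a)
  obtain t where t: "t \<in> simples" "\<Delta> = t \<otimes> s"
    using simples_complement(2)[OF mult(1)] by blast
  obtain t' where t': "t' \<in> simples" "\<Delta> = t' \<otimes> t"
    using simples_complement(2)[OF t(1)] by blast
  obtain b where b: "b \<in> carrier M" "\<Delta> \<otimes> a = b \<otimes> \<Delta>"
    using mult by blast
  have "\<Delta> \<otimes> s = t' \<otimes> \<Delta>"
    using t t' mult(1) by (metis m_assoc simples_carrier)
  then have "\<Delta> \<otimes> (s \<otimes> a) = (t' \<otimes> b) \<otimes> \<Delta>"
    using t' b mult Delta_closed by (metis m_assoc simples_carrier)
  then show ?case
    using t' b by (metis m_closed simples_carrier)
qed

lemma Delta_commute_left: "a \<in> carrier M \<Longrightarrow> \<exists>b \<in> carrier M. a \<otimes> \<Delta> = \<Delta> \<otimes> b"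
proof (induction a rule: simples_induct)
  case one
  then show ?case using Delta_closed by (intro bexI[of _ \<one>]) auto
next
  case (mult s a)
  obtain t where t: "t \<in> simples" "\<Delta> = s \<otimes> t"
    using simples_complement(1)[OF mult(1)] by blast
  obtain t' where t': "t' \<in> simples" "\<Delta> = t \<otimes> t'"
    using simples_complement(1)[OF t(1)] by blast
  obtain b where b: "b \<in> carrier M" "a \<otimes> \<Delta> = \<Delta> \<otimes> b"
    using mult by blast
  have "s \<otimes> \<Delta> = \<Delta> \<otimes> t'"
    using t t' mult(1) by (metis m_assoc simples_carrier)
  then have "s \<otimes> a \<otimes> \<Delta> = \<Delta> \<otimes> (t' \<otimes> b)"
    using t' b mult Delta_closed by (metis m_assoc simples_carrier)
  then show ?case
    using t' b by (metis m_closed simples_carrier)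
qed

lemma Delta_pow_commute: "a \<in> carrier M \<Longrightarrow> \<exists>b \<in> carrier M. \<Delta> [^] (n::nat) \<otimes> a = b \<otimes> \<Delta> [^] n"
proof (induction n arbitrary: a)
  case (Suc n)
  obtain b where b: "b \<in> carrier M" "\<Delta> \<otimes> a = b \<otimes> \<Delta>"
    using Delta_commute_right Suc by blast
  obtain c where c: "c \<in> carrier M" "\<Delta> [^] n \<otimes> b = c \<otimes> \<Delta> [^] n"
    using Suc.IH b by blast
  have "\<Delta> [^] Suc n \<otimes> a = \<Delta> [^] n \<otimes> b \<otimes> \<Delta>"
    using b Suc.prems Delta_closed by (simp add: m_assoc)
  also have "\<dots> = c \<otimes> \<Delta> [^] Suc n"
    using c Delta_closed by (simp add: m_assoc)
  finally show ?case
    using c by blast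
qed auto

text \<open>Prefixing a simple \<open>s\<close> costs one more factor
  \<open>\<Delta> = t \<otimes> s\<close>, which is first moved past the cofactor
  \<open>c\<close>.\<close>

lemma right_divides_Delta_pow: "a \<in> carrier M \<Longrightarrow> \<exists>n::nat. \<exists>c \<in> carrier M. \<Delta> [^] n = c \<otimes> a"
proof (induction a rule: simples_induct)
  case one
  then show ?case by (intro exI[of _ 0] bexI[of _ \<one>]) auto
next
  case (mult s a)
  obtain n :: nat and c where c: "c \<in> carrier M" "\<Delta> [^] n = c \<otimes> a"
    using mult by blast
  obtain t where t: "t \<in> simples" "\<Delta> = t \<otimes> s"
    using simples_complement(2)[OF mult(1)] by blast
  obtain d where d: "d \<in> carrier M" "\<Delta> \<otimes> c = d \<otimes> \<Delta>"
    using Delta_commute_right c by blast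
  have "\<Delta> [^] Suc n = \<Delta> \<otimes> c \<otimes> a"
    using c mult Delta_closed nat_pow_Suc2[OF Delta_closed, of n]
    by (simp add: m_assoc del: nat_pow_Suc)
  also have "\<dots> = d \<otimes> (t \<otimes> s) \<otimes> a"
    using d t by simp
  also have "\<dots> = (d \<otimes> t) \<otimes> (s \<otimes> a)"
    using d t mult by (simp add: m_assoc simples_carrier)
  finally show ?case
    using d t by (metis m_closed simples_carrier)
qed

text \<open>Otherwise repeating \<open>[a, b]\<close> would factor the identity into arbitrarily
  many non-identity elements.\<close>

lemma no_units:
  assumes "a \<in> carrier M" "b \<in> carrier M" "a \<otimes> b = \<one>"
  shows "a = \<one>"
proof (rule ccontr)
  assume a: "a \<noteq> \<one>"
  then have b: "b \<noteq> \<one>"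
    using assms by auto
  obtain N where N: "\<And>w. \<lbrakk>w \<in> lists (carrier M - {\<one>}); word_prod M w = \<one>\<rbrakk> \<Longrightarrow> length w \<le> N"
    using bounded_factorizations[of \<one>] by auto
  define w where "w n = concat (replicate n [a, b])" for n
  have "w n \<in> lists (carrier M - {\<one>}) \<and> word_prod M (w n) = \<one> \<and> length (w n) = 2 * n" for n
    using assms a b by (induction n) (auto simp: w_def simp flip: m_assoc)
  from this[of "Suc N"] N[of "w (Suc N)"] show False
    by simp
qed

end

section \<open>The positive cone of a group of fractions\<close>

lemma garside_group_of_fractions:
  fixes M :: "('a, 'm) monoid_scheme" and G :: "('g, 'n) monoid_scheme"
  assumes "garside_monoid M \<Delta>" "group_of_fractions M G \<iota>"
  shows "garside_group G (\<iota> ` carrier M) (\<iota> \<Delta>)"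
    and "{s \<in> \<iota> ` carrier M. inv\<^bsub>G\<^esub> s \<otimes>\<^bsub>G\<^esub> \<iota> \<Delta> \<in> \<iota> ` carrier M} = \<iota> ` left_divisors M \<Delta>"
proof -
  interpret M: garside_monoid M \<Delta> by fact
  interpret group_of_fractions M G \<iota> by fact
  let ?P = "\<iota> ` carrier M"
  have \<iota>_closed [simp]: "\<iota> a \<in> carrier G" if "a \<in> carrier M" for a
    using that embedding_hom by (rule hom_in_carrier[rotated])
  have \<iota>_mult: "\<iota> (a \<otimes>\<^bsub>M\<^esub> b) = \<iota> a \<otimes>\<^bsub>G\<^esub> \<iota> b" if "a \<in> carrier M" "b \<in> carrier M" for a b
    using that embedding_hom by (simp add: hom_mult)
  have \<iota>_pow: "\<iota> (a [^]\<^bsub>M\<^esub> (n::nat)) = \<iota> a [^]\<^bsub>G\<^esub> n" if "a \<in> carrier M" for a n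
    using that by (induction n) (simp_all add: embedding_one \<iota>_mult)
  have P_mult: "x \<otimes>\<^bsub>G\<^esub> y \<in> ?P" if "x \<in> ?P" "y \<in> ?P" for x y
    using that by (auto simp flip: \<iota>_mult)
  \<comment> \<open>On the image of \<open>M\<close> the group order is left divisibility, by
    injectivity of \<open>\<iota>\<close>; so left gcds will serve as meets.\<close>
  have divides: "inv\<^bsub>G\<^esub> \<iota> a \<otimes>\<^bsub>G\<^esub> \<iota> c \<in> ?P \<longleftrightarrow> a divides\<^bsub>M\<^esub> c"
    if "a \<in> carrier M" "c \<in> carrier M" for a c
  proof
    assume "inv\<^bsub>G\<^esub> \<iota> a \<otimes>\<^bsub>G\<^esub> \<iota> c \<in> ?P"
    then obtain b where b: "b \<in> carrier M" "inv\<^bsub>G\<^esub> \<iota> a \<otimes>\<^bsub>G\<^esub> \<iota> c = \<iota> b"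
      by blast
    then have "\<iota> c = \<iota> (a \<otimes>\<^bsub>M\<^esub> b)"
      using that by (metis G.inv_solve_left' \<iota>_closed \<iota>_mult)
    then have "c = a \<otimes>\<^bsub>M\<^esub> b"
      using b that embedding_inj by (simp add: inj_on_eq_iff)
    then show "a divides\<^bsub>M\<^esub> c"
      using b by (auto simp: factor_def)
  next
    assume "a divides\<^bsub>M\<^esub> c"
    then obtain b where "b \<in> carrier M" "c = a \<otimes>\<^bsub>M\<^esub> b"
      by (auto simp: factor_def)
    then have "inv\<^bsub>G\<^esub> \<iota> a \<otimes>\<^bsub>G\<^esub> \<iota> c = \<iota> b"
      using that by (simp add: \<iota>_mult flip: G.m_assoc)
    then show "inv\<^bsub>G\<^esub> \<iota> a \<otimes>\<^bsub>G\<^esub> \<iota> c \<in> ?P"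
      using \<open>b \<in> carrier M\<close> by simp
  qed
  show simples: "{s \<in> ?P. inv\<^bsub>G\<^esub> s \<otimes>\<^bsub>G\<^esub> \<iota> \<Delta> \<in> ?P} = \<iota> ` left_divisors M \<Delta>"
    using divides M.Delta_closed by (auto simp: left_divisors_def)
  show "garside_group G ?P (\<iota> \<Delta>)"
  proof
    show "?P \<subseteq> carrier G" by auto
    show "\<one>\<^bsub>G\<^esub> \<in> ?P"
      using embedding_one M.one_closed by (metis image_eqI)
    show "\<iota> \<Delta> \<in> ?P"
      using M.Delta_closed by simp
    show "x \<otimes>\<^bsub>G\<^esub> y \<in> ?P" if "x \<in> ?P" "y \<in> ?P" for x y
      using P_mult that .
    show "x = \<one>\<^bsub>G\<^esub>" if "x \<in> ?P" "inv\<^bsub>G\<^esub> x \<in> ?P" for x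
    proof -
      obtain a b where ab: "a \<in> carrier M" "b \<in> carrier M" "x = \<iota> a" "inv\<^bsub>G\<^esub> x = \<iota> b"
        using \<open>x \<in> ?P\<close> \<open>inv\<^bsub>G\<^esub> x \<in> ?P\<close> by blast
      then have "\<iota> (a \<otimes>\<^bsub>M\<^esub> b) = \<iota> \<one>\<^bsub>M\<^esub>"
        by (metis G.r_inv \<iota>_closed \<iota>_mult embedding_one)
      then have "a \<otimes>\<^bsub>M\<^esub> b = \<one>\<^bsub>M\<^esub>"
        using ab embedding_inj by (simp add: inj_on_eq_iff)
      then show ?thesis
        using M.no_units ab embedding_one by metis
    qed
    show "\<iota> \<Delta> \<otimes>\<^bsub>G\<^esub> x \<otimes>\<^bsub>G\<^esub> inv\<^bsub>G\<^esub> \<iota> \<Delta> \<in> ?P" if x: "x \<in> ?P" for x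
    proof -
      obtain a b where ab: "a \<in> carrier M" "x = \<iota> a" "b \<in> carrier M" "\<Delta> \<otimes>\<^bsub>M\<^esub> a = b \<otimes>\<^bsub>M\<^esub> \<Delta>"
        using x M.Delta_commute_right by blast
      then have "\<iota> \<Delta> \<otimes>\<^bsub>G\<^esub> x = \<iota> b \<otimes>\<^bsub>G\<^esub> \<iota> \<Delta>"
        using M.Delta_closed by (metis \<iota>_mult)
      then have "\<iota> \<Delta> \<otimes>\<^bsub>G\<^esub> x \<otimes>\<^bsub>G\<^esub> inv\<^bsub>G\<^esub> \<iota> \<Delta> = \<iota> b"
        using ab M.Delta_closed by (simp add: G.m_assoc)
      then show ?thesis
        using ab by simp
    qed
    show "inv\<^bsub>G\<^esub> \<iota> \<Delta> \<otimes>\<^bsub>G\<^esub> x \<otimes>\<^bsub>G\<^esub> \<iota> \<Delta> \<in> ?P" if x: "x \<in> ?P" for x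
    proof -
      obtain a b where ab: "a \<in> carrier M" "x = \<iota> a" "b \<in> carrier M" "a \<otimes>\<^bsub>M\<^esub> \<Delta> = \<Delta> \<otimes>\<^bsub>M\<^esub> b"
        using x M.Delta_commute_left by blast
      then have "x \<otimes>\<^bsub>G\<^esub> \<iota> \<Delta> = \<iota> \<Delta> \<otimes>\<^bsub>G\<^esub> \<iota> b"
        using M.Delta_closed by (metis \<iota>_mult)
      then have "inv\<^bsub>G\<^esub> \<iota> \<Delta> \<otimes>\<^bsub>G\<^esub> (x \<otimes>\<^bsub>G\<^esub> \<iota> \<Delta>) = \<iota> b"
        using ab M.Delta_closed by (simp flip: G.m_assoc)
      then show ?thesis
        using ab M.Delta_closed by (simp add: G.m_assoc)
    qed
    show "finite {s \<in> ?P. inv\<^bsub>G\<^esub> s \<otimes>\<^bsub>G\<^esub> \<iota> \<Delta> \<in> ?P}"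
      unfolding simples using M.Delta_divisors_finite by simp
    show "\<exists>n::nat. \<iota> \<Delta> [^]\<^bsub>G\<^esub> n \<otimes>\<^bsub>G\<^esub> g \<in> ?P" if "g \<in> carrier G" for g
    proof -
      obtain a b where ab: "a \<in> carrier M" "b \<in> carrier M" "g = \<iota> a \<otimes>\<^bsub>G\<^esub> inv\<^bsub>G\<^esub> \<iota> b"
        using fractions \<open>g \<in> carrier G\<close> by blast
      \<comment> \<open>The power of \<open>\<Delta>\<close> absorbs the denominator: in
        \<open>M\<close>, \<open>\<Delta> [^] n \<otimes> a = d \<otimes> c \<otimes> b\<close>, so
        \<open>b\<close> cancels and leaves the image of \<open>d \<otimes> c\<close>.\<close>
      obtain n :: nat and c where c: "c \<in> carrier M" "\<Delta> [^]\<^bsub>M\<^esub> n = c \<otimes>\<^bsub>M\<^esub> b"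
        using M.right_divides_Delta_pow ab by blast
      obtain d where d: "d \<in> carrier M" "\<Delta> [^]\<^bsub>M\<^esub> n \<otimes>\<^bsub>M\<^esub> a = d \<otimes>\<^bsub>M\<^esub> \<Delta> [^]\<^bsub>M\<^esub> n"
        using M.Delta_pow_commute ab by blast
      have "\<iota> \<Delta> [^]\<^bsub>G\<^esub> n \<otimes>\<^bsub>G\<^esub> \<iota> a = \<iota> (\<Delta> [^]\<^bsub>M\<^esub> n \<otimes>\<^bsub>M\<^esub> a)"
        using ab M.Delta_closed by (simp add: \<iota>_mult \<iota>_pow)
      also have "\<dots> = \<iota> d \<otimes>\<^bsub>G\<^esub> \<iota> c \<otimes>\<^bsub>G\<^esub> \<iota> b"
        unfolding d(2) c(2) using ab c d by (simp add: \<iota>_mult G.m_assoc)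
      finally have "\<iota> \<Delta> [^]\<^bsub>G\<^esub> n \<otimes>\<^bsub>G\<^esub> g = \<iota> d \<otimes>\<^bsub>G\<^esub> \<iota> c"
        using ab c d M.Delta_closed by (simp add: G.m_assoc flip: G.m_assoc[of _ "\<iota> a"])
      then show ?thesis
        using c d P_mult by (metis image_eqI)
    qed
    show "\<exists>m \<in> ?P. inv\<^bsub>G\<^esub> m \<otimes>\<^bsub>G\<^esub> x \<in> ?P \<and> inv\<^bsub>G\<^esub> m \<otimes>\<^bsub>G\<^esub> y \<in> ?P \<and> (\<forall>z \<in> ?P.
        inv\<^bsub>G\<^esub> z \<otimes>\<^bsub>G\<^esub> x \<in> ?P \<longrightarrow> inv\<^bsub>G\<^esub> z \<otimes>\<^bsub>G\<^esub> y \<in> ?P \<longrightarrow> inv\<^bsub>G\<^esub> z \<otimes>\<^bsub>G\<^esub> m \<in> ?P)"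
      if x: "x \<in> ?P" and y: "y \<in> ?P" for x y
    proof -
      obtain a b where ab: "a \<in> carrier M" "b \<in> carrier M" "x = \<iota> a" "y = \<iota> b"
        using x y by blast
      obtain c where c: "c \<in> carrier M" "c gcdof\<^bsub>M\<^esub> a b"
        using M.left_gcd ab by blast
      then show ?thesis
        using ab by (intro bexI[of _ "\<iota> c"]) (auto simp: divides isgcd_def)
    qed
  qed
qed

theorem proposition3p13:
  fixes M :: "('a, 'm) monoid_scheme"
    and G :: "('g, 'n) monoid_scheme"
    and \<Delta> :: 'a and \<iota> :: "'a \<Rightarrow> 'g" and S X :: "'g set"
  assumes "garside_monoid M \<Delta>"
    and "group_of_fractions M G \<iota>"
    and "S = garside_generators M \<Delta> \<iota>"
    and "X = S \<union> m_inv G ` S"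
  shows "\<exists>r. linear_order_on X r \<and> shortlex_automatic G X r"
proof -
  interpret M: garside_monoid M \<Delta> by fact
  interpret group_of_fractions M G \<iota> by fact
  interpret garside_group G "\<iota> ` carrier M" "\<iota> \<Delta>"
    by (rule garside_group_of_fractions(1)[OF assms(1,2)])
  \<comment> \<open>By injectivity the identity may be removed after applying
    \<open>\<iota>\<close>, which is the form used in \<open>alphabet_eq\<close>.\<close>
  have "S = \<iota> ` left_divisors M \<Delta> - {\<one>\<^bsub>G\<^esub>}"
    unfolding assms(3) garside_generators_def embedding_one[symmetric]
    using inj_on_image_set_diff[OF embedding_inj, of "left_divisors M \<Delta>" "{\<one>\<^bsub>M\<^esub>}"]
    by (auto simp: left_divisors_def)
  then have "X = alphabet"
    unfolding assms(4) alphabet_eq le_def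
    using garside_group_of_fractions(2)[OF assms(1,2)] by simp
  then show ?thesis
    using ex_shortlex_automatic by simp
qed

end
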